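(* There exist two dimension functions $h_1,h_2$ with $h_2\prec h_1$ and two compact sets $K_1,K_2\subset\mathbb R$ such that $K_j$ is an $h_j$-set for $j\in\{1,2\}$, the set $K_1$ has the extension property, and the set $K_2$ does not have the extension property.
   Context: A dimension function is a continuous nondecreasing function $h:(0,T)\to(0,\infty)$ (for some $T>0$) with $h(t)\to0$ as $t\to0$. $h_2\prec h_1$ means $h_2(t)=o(h_1(t))$ as $t\to 0$. The $h$-Hausdorff measure of $E\subset\mathbb R$ is $\Lambda_h(E)=\lim_{\delta\to0}\inf\{\sum h(|G_i|):E\subset\bigcup G_i,\ |G_i|\le\delta\}$, over at most countable coverings by intervals $G_i$ (open or closed), $|G|$ being the length. $E$ is an $h$-set if $0<\Lambda_h(E)<\infty$. Extension property: for a perfect compact set $K\subset\mathbb R$, $\mathcal E(K)$ is the Fréchet space of Whitney functions on $K$, i.e. of traces $f=F|_K$ of functions $F\in C^\infty(\mathbb R)$ (since $K$ is perfect, $f$ determines the derivatives $f^{(k)}=F^{(k)}|_K$), with the topology given by the norms $$\|f\|_q=|f|_{q,K}+\sup\Big\{\frac{|(R_y^qf)^{(k)}(x)|}{|x-y|^{q-k}}:x,y\in K,\ x\ne y,\ k=0,\dots,q\Big\},\quad q=0,1,2,\dots,$$ where $|f|_{q,K}=\sup\{|f^{(k)}(x)|:x\in K,k\le q\}$ and $R_y^qf=f-T_y^qf$ is the Taylor remainder. $K$ has the extension property if there is a continuous linear operator $W:\mathcal E(K)\to C^\infty(\mathbb R)$ with $W(f)|_K=f$ for all $f\in\mathcal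 E(K)$. The paper considers only perfect compact sets; $K_1,K_2$ are understood to be perfect. *)

theory Defs
  imports "HOL-Analysis.Analysis" "HOL-Library.Landau_Symbols"
begin

section \<open>Dimension functions and Hausdorff measures\<close>

text \<open>
  A dimension function lives on some interval \<open>(0, T)\<close>; it is represented by a total function
  whose values outside \<open>(0, T)\<close> play no role below (only arguments tending to \<open>0\<close>
  from the right matter).
\<close>

definition dimension_function :: "(real \<Rightarrow> real) \<Rightarrow> bool" where
  "dimension_function h \<longleftrightarrow>
     (\<exists>T>0. continuous_on {0<..<T} h \<and> mono_on {0<..<T} h \<and> (\<forall>t\<in>{0<..<T}. 0 < h t)) \<and>
     (h \<longlongrightarrow> 0) (at_right 0)"

definition dim_prec :: "(real \<Rightarrow> real) \<Rightarrow> (real \<Rightarrow> real) \<Rightarrow> bool" (infix "\<prec>\<^sub>d" 50) where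
  "h2 \<prec>\<^sub>d h1 \<longleftrightarrow> h2 \<in> o[at_right 0](h1)"

text \<open>
  The covering intervals are nondegenerate, since \<open>h\<close> is only given for positive lengths.
  As \<open>h t\<close> tends to \<open>0\<close>, admitting single points with \<open>h 0 = 0\<close> would give the same measure.
\<close>

definition interval_covers :: "real \<Rightarrow> real set \<Rightarrow> real set set set" where
  "interval_covers \<delta> E =
     {\<G>. countable \<G> \<and> E \<subseteq> \<Union>\<G> \<and>
          (\<forall>G\<in>\<G>. (\<exists>a b. a < b \<and> (G = {a<..<b} \<or> G = {a..b})) \<and> measure lborel G \<le> \<delta>)}"

definition hausdorff_content :: "(real \<Rightarrow> real) \<Rightarrow> real \<Rightarrow> real set \<Rightarrow> ennreal" where
  "hausdorff_content h \<delta> E =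
     (INF \<G>\<in>interval_covers \<delta> E. \<Sum>\<^sub>\<infinity>G\<in>\<G>. ennreal (h (measure lborel G)))"

definition hausdorff_measure :: "(real \<Rightarrow> real) \<Rightarrow> real set \<Rightarrow> ennreal" where
  "hausdorff_measure h E = Lim (at_right 0) (\<lambda>\<delta>. hausdorff_content h \<delta> E)"

definition h_set :: "(real \<Rightarrow> real) \<Rightarrow> real set \<Rightarrow> bool" where
  "h_set h E \<longleftrightarrow> 0 < hausdorff_measure h E \<and> hausdorff_measure h E < \<infinity>"

text \<open>The limit defining the Hausdorff measure always exists, by monotonicity.\<close>

lemma hausdorff_content_antimono:
  assumes "\<delta> \<le> \<delta>'"
  shows "hausdorff_content h \<delta>' E \<le> hausdorff_content h \<delta> E"
proof -
  have "interval_covers \<delta> E \<subseteq> interval_covers \<delta>' E"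
    unfolding interval_covers_def using order_trans[OF _ assms] by blast
  then show ?thesis
    unfolding hausdorff_content_def by (intro INF_superset_mono) auto
qed

lemma tendsto_hausdorff_content:
  "((\<lambda>\<delta>. hausdorff_content h \<delta> E) \<longlongrightarrow> (SUP \<delta>\<in>{0<..}. hausdorff_content h \<delta> E)) (at_right 0)"
proof (rule order_tendstoI)
  fix a assume "a < (SUP \<delta>\<in>{0<..}. hausdorff_content h \<delta> E)"
  then obtain d where d: "0 < d" "a < hausdorff_content h d E"
    by (auto simp: less_SUP_iff)
  have "\<forall>\<^sub>F \<delta> in at_right 0. \<delta> \<in> {0<..<d}"
    using d(1) by (rule eventually_at_right_real)
  then show "\<forall>\<^sub>F \<delta> in at_right 0. a < hausdorff_content h \<delta> E"
  proof eventually_elim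
    case (elim \<delta>)
    then show ?case
      by (intro less_le_trans[OF d(2) hausdorff_content_antimono]) simp
  qed
next
  fix a assume a: "(SUP \<delta>\<in>{0<..}. hausdorff_content h \<delta> E) < a"
  have "\<forall>\<^sub>F \<delta> in at_right 0. \<delta> \<in> {0<..<(1::real)}"
    by (rule eventually_at_right_real) simp
  then show "\<forall>\<^sub>F \<delta> in at_right 0. hausdorff_content h \<delta> E < a"
  proof eventually_elim
    case (elim \<delta>)
    then show ?case
      by (intro le_less_trans[OF SUP_upper a]) simp
  qed
qed

lemma hausdorff_measure_eq_SUP:
  "hausdorff_measure h E = (SUP \<delta>\<in>{0<..}. hausdorff_content h \<delta> E)"
  unfolding hausdorff_measure_def
  by (rule tendsto_Lim[OF _ tendsto_hausdorff_content]) simp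


section \<open>Smooth functions and Whitney functions\<close>

definition smooth_functions :: "(real \<Rightarrow> real) set" where
  "smooth_functions = {F. \<forall>k x. (deriv ^^ k) F differentiable (at x)}"

definition perfect_set :: "real set \<Rightarrow> bool" where
  "perfect_set K \<longleftrightarrow> {x. x islimpt K} = K"

text \<open>
  Functions on \<open>K\<close> are represented by functions on \<open>\<real>\<close> that vanish off \<open>K\<close>,
  so that the pointwise operations are those of the vector space of functions on \<open>K\<close>.
\<close>

definition trace_on :: "real set \<Rightarrow> (real \<Rightarrow> real) \<Rightarrow> real \<Rightarrow> real" where
  "trace_on K F = (\<lambda>x. if x \<in> K then F x else 0)"

definition whitney_functions :: "real set \<Rightarrow> (real \<Rightarrow> real) set" where
  "whitney_functions K = trace_on K ` smooth_functions"

text \<open>For perfect \<open>K\<close> the description below is indeed unique; see \<open>wderiv_eq\<close>.\<close>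

definition wderiv :: "real set \<Rightarrow> (real \<Rightarrow> real) \<Rightarrow> nat \<Rightarrow> real \<Rightarrow> real" where
  "wderiv K f k x =
     (THE c. \<exists>F\<in>smooth_functions. (\<forall>z\<in>K. F z = f z) \<and> c = (deriv ^^ k) F x)"

lemma smooth_has_derivs:
  assumes "F \<in> smooth_functions"
  shows "((deriv ^^ k) F has_real_derivative (deriv ^^ Suc k) F x) (at x)"
  using assms unfolding smooth_functions_def
  by (simp add: DERIV_deriv_iff_real_differentiable)

lemma smooth_eq_on_perfect:
  assumes K: "perfect_set K" and F: "F \<in> smooth_functions" and G: "G \<in> smooth_functions"
    and eq: "\<And>z. z \<in> K \<Longrightarrow> F z = G z" and x: "x \<in> K"
  shows "(deriv ^^ k) F x = (deriv ^^ k) G x"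
  using x
proof (induction k arbitrary: x)
  case 0
  then show ?case using eq by simp
next
  case (Suc k)
  have "x islimpt K" using K Suc.prems by (auto simp: perfect_set_def)
  then have nt: "at x within K \<noteq> bot" by (simp add: trivial_limit_within)
  have f: "((deriv ^^ k) F has_field_derivative (deriv ^^ Suc k) F x) (at x within K)"
    by (rule has_field_derivative_at_within[OF smooth_has_derivs[OF F]])
  have g: "((deriv ^^ k) G has_field_derivative (deriv ^^ Suc k) G x) (at x within K)"
    by (rule has_field_derivative_at_within[OF smooth_has_derivs[OF G]])
  have "((deriv ^^ k) F has_field_derivative (deriv ^^ Suc k) G x) (at x within K)"
    by (rule has_field_derivative_transform_within[OF g zero_less_one Suc.prems])
      (simp add: Suc.IH)
  then show ?case
    using f unfolding has_field_derivative_iff by (intro tendsto_unique[OF nt])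
qed

lemma wderiv_eq:
  assumes "perfect_set K" "F \<in> smooth_functions" "\<And>z. z \<in> K \<Longrightarrow> F z = f z" "x \<in> K"
  shows "wderiv K f k x = (deriv ^^ k) F x"
  unfolding wderiv_def
proof (rule the_equality)
  show "\<exists>G\<in>smooth_functions. (\<forall>z\<in>K. G z = f z) \<and> (deriv ^^ k) F x = (deriv ^^ k) G x"
    using assms by blast
next
  fix c assume "\<exists>G\<in>smooth_functions. (\<forall>z\<in>K. G z = f z) \<and> c = (deriv ^^ k) G x"
  then obtain G where "G \<in> smooth_functions" "\<forall>z\<in>K. G z = f z" "c = (deriv ^^ k) G x"
    by blast
  then show "c = (deriv ^^ k) F x"
    using smooth_eq_on_perfect[of K G F x k] assms by auto
qed


section \<open>Seminorms and topologies\<close>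

definition deriv_sup :: "(nat \<Rightarrow> real \<Rightarrow> real) \<Rightarrow> nat \<Rightarrow> real set \<Rightarrow> real" where
  "deriv_sup D q A = Sup {\<bar>D k x\<bar> | k x. k \<le> q \<and> x \<in> A}"

definition taylor :: "real set \<Rightarrow> (real \<Rightarrow> real) \<Rightarrow> nat \<Rightarrow> real \<Rightarrow> real \<Rightarrow> real" where
  "taylor K f q y x = (\<Sum>i\<le>q. wderiv K f i y * (x - y) ^ i / fact i)"

definition taylor_rem :: "real set \<Rightarrow> (real \<Rightarrow> real) \<Rightarrow> nat \<Rightarrow> real \<Rightarrow> real \<Rightarrow> real" where
  "taylor_rem K f q y = trace_on K (\<lambda>x. f x - taylor K f q y x)"

text \<open>
  For a nonempty perfect compact \<open>K\<close> and \<open>f \<in> whitney_functions K\<close>, the sets below are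
  nonempty and bounded above, so the real suprema are the intended ones.
\<close>

definition whitney_norm :: "real set \<Rightarrow> nat \<Rightarrow> (real \<Rightarrow> real) \<Rightarrow> real" where
  "whitney_norm K q f =
     deriv_sup (wderiv K f) q K +
     Sup {\<bar>wderiv K (taylor_rem K f q y) k x\<bar> / \<bar>x - y\<bar> ^ (q - k) | x y k.
            x \<in> K \<and> y \<in> K \<and> x \<noteq> y \<and> k \<le> q}"

definition smooth_seminorm :: "nat \<Rightarrow> (real \<Rightarrow> real) \<Rightarrow> real" where
  "smooth_seminorm p F = deriv_sup (\<lambda>k. (deriv ^^ k) F) p {- real p..real p}"

text \<open>
  The locally convex topology on the function space \<open>V\<close> given by the seminorms \<open>N 0, N 1, \<dots>\<close>:
  the balls of the single seminorms form a subbase.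
\<close>

definition seminorm_topology ::
  "(real \<Rightarrow> real) set \<Rightarrow> (nat \<Rightarrow> (real \<Rightarrow> real) \<Rightarrow> real) \<Rightarrow> (real \<Rightarrow> real) topology" where
  "seminorm_topology V N =
     topology_generated_by {{g \<in> V. N q (\<lambda>x. g x - f x) < e} | q f e. f \<in> V \<and> 0 < e}"

definition whitney_topology :: "real set \<Rightarrow> (real \<Rightarrow> real) topology" where
  "whitney_topology K = seminorm_topology (whitney_functions K) (whitney_norm K)"

definition smooth_topology :: "(real \<Rightarrow> real) topology" where
  "smooth_topology = seminorm_topology smooth_functions smooth_seminorm"

lemma topspace_seminorm_topology:
  assumes "\<And>q. N q (\<lambda>x. 0) = 0"
  shows "topspace (seminorm_topology V N) = V"
proof -
  let ?B = "{{g \<in> V. N q (\<lambda>x. g x - f x) < e} | q f e. f \<in> V \<and> 0 < e}"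
  have "\<Union>?B = V"
  proof (rule subset_antisym)
    show "\<Union>?B \<subseteq> V"
    proof (rule Union_least)
      fix U assume "U \<in> ?B"
      then obtain q f e where "U = {g \<in> V. N q (\<lambda>x. g x - f x) < e}"
        by (elim CollectE exE conjE)
      then show "U \<subseteq> V" by (simp only: Collect_restrict)
    qed
  next
    show "V \<subseteq> \<Union>?B"
    proof (rule subsetI)
      fix f assume f: "f \<in> V"
      show "f \<in> \<Union>?B"
      proof (rule UnionI)
        show "{g \<in> V. N 0 (\<lambda>x. g x - f x) < 1} \<in> ?B"
          by (rule CollectI, rule exI[of _ 0], rule exI[of _ f], rule exI[of _ 1])
            (intro conjI refl f zero_less_one)
        show "f \<in> {g \<in> V. N 0 (\<lambda>x. g x - f x) < 1}"
          using f by (simp add: assms)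
      qed
    qed
  qed
  then show ?thesis
    unfolding seminorm_topology_def topology_generated_by_topspace .
qed


section \<open>The extension property\<close>

definition linear_on_functions ::
  "(real \<Rightarrow> real) set \<Rightarrow> ((real \<Rightarrow> real) \<Rightarrow> real \<Rightarrow> real) \<Rightarrow> bool" where
  "linear_on_functions V W \<longleftrightarrow>
     (\<forall>f\<in>V. \<forall>g\<in>V. W (\<lambda>x. f x + g x) = (\<lambda>x. W f x + W g x)) \<and>
     (\<forall>c. \<forall>f\<in>V. W (\<lambda>x. c * f x) = (\<lambda>x. c * W f x))"

definition extension_property :: "real set \<Rightarrow> bool" where
  "extension_property K \<longleftrightarrow>
     (\<exists>W. W \<in> whitney_functions K \<rightarrow> smooth_functions \<and>
          linear_on_functions (whitney_functions K) W \<and>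
          continuous_map (whitney_topology K) smooth_topology W \<and>
          (\<forall>f\<in>whitney_functions K. trace_on K (W f) = f))"

end

theory Submission
  imports Defs "HOL-Computational_Algebra.Polynomial"
begin

text \<open>
  Take \<open>h\<^sub>1 t = sqrt t\<close> and \<open>h\<^sub>2 t = t\<close>. \<open>K\<^sub>2\<close> is \<open>{0}\<close> together with intervals
  \<open>[2\<^sup>-\<^sup>n, 2\<^sup>-\<^sup>n + l\<^sub>n]\<close>, where \<open>l\<^sub>n\<close> decreases faster than every power of \<open>2\<^sup>-\<^sup>n\<close>. The function
  equal to \<open>(x - 2\<^sup>-\<^sup>n)\<^sup>m\<close> on the \<open>n\<close>-th interval and to zero elsewhere has norms of order below
  \<open>m - 1\<close> of size \<open>l\<^sub>n\<close>, and norms of all orders of size a fixed power of \<open>2\<^sup>n\<close>. A continuous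
  extension operator would turn it into a smooth function that is tiny, has \<open>m\<close>-th derivative
  \<open>m!\<close> at \<open>2\<^sup>-\<^sup>n\<close> and moderate \<open>(m + 1)\<close>-st derivative; \<open>m\<close>-th differences rule this out.

  \<open>K\<^sub>1\<close> is the Cantor set of ratio \<open>1/4\<close>. The extension operator starts from an interpolation
  polynomial of \<open>f\<close> on the whole set and adds, for every cylinder, the difference between the
  interpolation polynomials on it and on its parent, cut off near the cylinder. The degree may
  tend to infinity with the level, which removes any fixed Taylor polynomial of \<open>f\<close> from almost
  all differences; by self-similarity the interpolation constants depend only on the degree, so
  if it grows slowly enough they cost a single factor \<open>4\<^sup>n\<close> at level \<open>n\<close>.
\<close>

section \<open>Smooth functions and cutoffs\<close>

text \<open>A Cantor set of ratio 1/4 fits three demands at once. Two children of length 1/4 each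
  carry half of the square root of the parent's length, so \<open>sqrt\<close> is its gauge. Cells
  of one level are at least two cell lengths apart, which leaves room for cutoffs reaching one
  length beyond a cell. The points at relative position 4^-j of a cylinder lie in the set, so the
  same nodes serve every cylinder. The operator loses two orders of differentiability: one power of
  4^n pays for the interpolation constants, another for the about 2^n corrections of a level, which
  are simply added up without regard to their supports. For the negative example the orders are
  chosen one after the other: Q from the continuity bound for the values, then m = Q + 2, then Q'
  from the bound for the derivative of order m + 1. The block length has to beat 2^-(n R) for R = Q
  + Q' m, which is known only once the operator is given; hence an exponent quadratic in n. That the
  m-th derivative of the extension is forced at all is due to perfectness, which lets the values on
  the set determine every derivative there.\<close>

lemma smooth_seqI:
  fixes D :: "nat \<Rightarrow> real \<Rightarrow> real"
  assumes "\<And>k x. (D k has_real_derivative D (Suc k) x) (at x)"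
  shows "D 0 \<in> smooth_functions" "(deriv ^^ k) (D 0) = D k"
proof -
  have *: "(deriv ^^ k) (D 0) = D k" for k
  proof (induction k)
    case (Suc k)
    have "deriv (D k) = D (Suc k)" for k using assms[THEN DERIV_imp_deriv] by blast
    then show ?case using Suc by simp
  qed simp
  then show "(deriv ^^ k) (D 0) = D k" .
  show "D 0 \<in> smooth_functions"
    using assms * by (auto simp: smooth_functions_def real_differentiable_def intro!: exI)
qed

text \<open>Recursion on the order with an existential derivative gives closure under products,
  inverses and composition by induction, without Leibniz or Faa di Bruno formulas.\<close>

primrec ndifferentiable :: "nat \<Rightarrow> (real \<Rightarrow> real) \<Rightarrow> bool" where
  "ndifferentiable 0 f \<longleftrightarrow> True"
| "ndifferentiable (Suc k) f \<longleftrightarrow>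
     (\<exists>f'. (\<forall>x. (f has_real_derivative f' x) (at x)) \<and> ndifferentiable k f')"

lemma ndifferentiable_SucI:
  "(\<And>x. (f has_real_derivative f' x) (at x)) \<Longrightarrow> ndifferentiable k f' \<Longrightarrow> ndifferentiable (Suc k) f"
  by auto

lemma ndifferentiable_mono: "ndifferentiable (Suc k) f \<Longrightarrow> ndifferentiable k f"
proof (induction k arbitrary: f)
  case (Suc k)
  then show ?case by (metis ndifferentiable.simps(2))
qed simp

lemma ndifferentiable_deriv:
  assumes "ndifferentiable (Suc k) f" shows "ndifferentiable k (deriv f)"
proof -
  obtain f' where f': "\<And>x. (f has_real_derivative f' x) (at x)" "ndifferentiable k f'"
    using assms by auto
  then have "deriv f = f'" by (auto simp: fun_eq_iff intro: DERIV_imp_deriv)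
  then show ?thesis using f' by simp
qed

lemma smooth_iff_ndifferentiable: "f \<in> smooth_functions \<longleftrightarrow> (\<forall>k. ndifferentiable k f)"
proof
  assume f: "f \<in> smooth_functions"
  have "ndifferentiable k ((deriv ^^ j) f)" for k j
  proof (induction k arbitrary: j)
    case (Suc k)
    then show ?case using smooth_has_derivs[OF f] by (metis ndifferentiable.simps(2))
  qed simp
  then show "\<forall>k. ndifferentiable k f" by (metis funpow_0)
next
  assume f: "\<forall>k. ndifferentiable k f"
  have "ndifferentiable k ((deriv ^^ j) f)" for k j
    by (induction j arbitrary: k) (use f in \<open>auto intro: ndifferentiable_deriv simp del: ndifferentiable.simps\<close>)
  note this[of "Suc 0"]
  then show "f \<in> smooth_functions"
    by (auto simp: smooth_functions_def real_differentiable_def)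
qed

lemma ndifferentiable_const: "ndifferentiable k (\<lambda>x. c)"
proof (induction k arbitrary: c)
  case (Suc k)
  then show ?case by (auto intro!: exI[of _ "\<lambda>x. 0"])
qed simp

lemma ndifferentiable_ident: "ndifferentiable k (\<lambda>x. x)"
proof (cases k)
  case (Suc l)
  then show ?thesis by (auto intro!: exI[of _ "\<lambda>x. 1"] ndifferentiable_const)
qed simp

lemma ndifferentiable_add:
  "ndifferentiable k f \<Longrightarrow> ndifferentiable k g \<Longrightarrow> ndifferentiable k (\<lambda>x. f x + g x)"
proof (induction k arbitrary: f g)
  case (Suc k)
  then obtain f' g' where "\<And>x. (f has_real_derivative f' x) (at x)" "ndifferentiable k f'"
    "\<And>x. (g has_real_derivative g' x) (at x)" "ndifferentiable k g'" by auto
  then have "((\<lambda>x. f x + g x) has_real_derivative f' x + g' x) (at x)"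
    "ndifferentiable k (\<lambda>x. f' x + g' x)" for x using Suc.IH by (auto intro: DERIV_add)
  then show ?case by (rule ndifferentiable_SucI)
qed simp

lemma ndifferentiable_mult:
  "ndifferentiable k f \<Longrightarrow> ndifferentiable k g \<Longrightarrow> ndifferentiable k (\<lambda>x. f x * g x)"
proof (induction k arbitrary: f g)
  case (Suc k)
  then obtain f' g' where *: "\<And>x. (f has_real_derivative f' x) (at x)" "ndifferentiable k f'"
    "\<And>x. (g has_real_derivative g' x) (at x)" "ndifferentiable k g'" by auto
  have "((\<lambda>x. f x * g x) has_real_derivative f' x * g x + f x * g' x) (at x)" for x
    using DERIV_mult[OF *(1,3)[of x]] by (simp add: algebra_simps)
  moreover have "ndifferentiable k (\<lambda>x. f' x * g x + f x * g' x)"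
    by (rule ndifferentiable_add[OF Suc.IH[OF *(2) ndifferentiable_mono[OF Suc.prems(2)]]
          Suc.IH[OF ndifferentiable_mono[OF Suc.prems(1)] *(4)]])
  ultimately show ?case by (rule ndifferentiable_SucI)
qed simp

lemma ndifferentiable_inverse:
  assumes nz: "\<And>x. f x \<noteq> 0"
  shows "ndifferentiable k f \<Longrightarrow> ndifferentiable k (\<lambda>x. inverse (f x))"
proof (induction k)
  case (Suc k)
  then obtain f' where *: "\<And>x. (f has_real_derivative f' x) (at x)" "ndifferentiable k f'"
    by auto
  let ?g = "\<lambda>x. (-1) * (f' x * (inverse (f x) * inverse (f x)))"
  have "((\<lambda>x. inverse (f x)) has_real_derivative ?g x) (at x)" for x
    by (rule DERIV_cong[OF DERIV_inverse'[OF *(1) nz]]) (simp add: algebra_simps)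
  moreover have "ndifferentiable k ?g"
    using * Suc ndifferentiable_mono by (intro ndifferentiable_mult ndifferentiable_const) auto
  ultimately show ?case by (rule ndifferentiable_SucI)
qed simp

lemma ndifferentiable_compose:
  assumes g: "\<And>k. ndifferentiable k g"
  shows "ndifferentiable k f \<Longrightarrow> ndifferentiable k (\<lambda>x. f (g x))"
proof (induction k arbitrary: f)
  case (Suc k)
  then obtain f' where f': "\<And>x. (f has_real_derivative f' x) (at x)" "ndifferentiable k f'" by auto
  obtain g' where g': "\<And>x. (g has_real_derivative g' x) (at x)" "ndifferentiable k g'"
    using g[of "Suc k"] by auto
  have "((\<lambda>x. f (g x)) has_real_derivative f' (g x) * g' x) (at x)" for x
    using DERIV_chain2[OF f'(1) g'(1)] .
  moreover have "ndifferentiable k (\<lambda>x. f' (g x) * g' x)"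
    using f' g' Suc.IH by (intro ndifferentiable_mult)
  ultimately show ?case by (rule ndifferentiable_SucI)
qed simp

lemma smooth_const [simp, intro]: "(\<lambda>x. c) \<in> smooth_functions"
  and smooth_ident [simp, intro]: "(\<lambda>x. x) \<in> smooth_functions"
  by (auto simp: smooth_iff_ndifferentiable ndifferentiable_const ndifferentiable_ident)

lemma smooth_add [intro]:
  "f \<in> smooth_functions \<Longrightarrow> g \<in> smooth_functions \<Longrightarrow> (\<lambda>x. f x + g x) \<in> smooth_functions"
  by (auto simp: smooth_iff_ndifferentiable intro: ndifferentiable_add)

lemma smooth_mult [intro]:
  "f \<in> smooth_functions \<Longrightarrow> g \<in> smooth_functions \<Longrightarrow> (\<lambda>x. f x * g x) \<in> smooth_functions"
  by (auto simp: smooth_iff_ndifferentiable intro: ndifferentiable_mult)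

lemma smooth_diff [intro]:
  "f \<in> smooth_functions \<Longrightarrow> g \<in> smooth_functions \<Longrightarrow> (\<lambda>x. f x - g x) \<in> smooth_functions"
  using smooth_add[of f "\<lambda>x. (-1) * g x"] smooth_mult[of "\<lambda>x. -1" g] by simp

lemma smooth_compose:
  "f \<in> smooth_functions \<Longrightarrow> g \<in> smooth_functions \<Longrightarrow> (\<lambda>x. f (g x)) \<in> smooth_functions"
  by (auto simp: smooth_iff_ndifferentiable intro: ndifferentiable_compose)

lemma smooth_divide:
  assumes "f \<in> smooth_functions" "g \<in> smooth_functions" "\<And>x. g x \<noteq> 0"
  shows "(\<lambda>x. f x / g x) \<in> smooth_functions"
proof -
  have "(\<lambda>x. inverse (g x)) \<in> smooth_functions"
    using assms by (auto simp: smooth_iff_ndifferentiable intro: ndifferentiable_inverse)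
  then show ?thesis unfolding divide_inverse using assms(1) by (rule smooth_mult[rotated])
qed

lemma smooth_sum [intro]:
  assumes "\<And>i. i \<in> A \<Longrightarrow> f i \<in> smooth_functions"
  shows "(\<lambda>x. \<Sum>i\<in>A. f i x) \<in> smooth_functions"
  using assms by (induction A rule: infinite_finite_induct) auto

lemma smooth_poly [simp, intro]: "poly p \<in> smooth_functions"
proof (induction p)
  case 0
  show ?case by simp
next
  case (pCons a p)
  have "(\<lambda>x. a + x * poly p x) \<in> smooth_functions"
    by (intro smooth_add smooth_mult smooth_const smooth_ident pCons)
  then show ?case by (simp add: poly_pCons[abs_def])
qed

section \<open>Rules for higher derivatives\<close>

lemma higher_deriv_add:
  assumes f: "f \<in> smooth_functions" and g: "g \<in> smooth_functions"
  shows "(deriv ^^ k) (\<lambda>x. f x + g x) x = (deriv ^^ k) f x + (deriv ^^ k) g x"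
  using smooth_seqI(2)[of "\<lambda>k x. (deriv ^^ k) f x + (deriv ^^ k) g x" k,
      OF DERIV_add[OF smooth_has_derivs[OF f] smooth_has_derivs[OF g]]] by (simp add: fun_eq_iff)

lemma higher_deriv_diff:
  assumes f: "f \<in> smooth_functions" and g: "g \<in> smooth_functions"
  shows "(deriv ^^ k) (\<lambda>x. f x - g x) x = (deriv ^^ k) f x - (deriv ^^ k) g x"
  using smooth_seqI(2)[of "\<lambda>k x. (deriv ^^ k) f x - (deriv ^^ k) g x" k,
      OF DERIV_diff[OF smooth_has_derivs[OF f] smooth_has_derivs[OF g]]] by (simp add: fun_eq_iff)

lemma higher_deriv_cmult:
  assumes f: "f \<in> smooth_functions"
  shows "(deriv ^^ k) (\<lambda>x. c * f x) x = c * (deriv ^^ k) f x"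
  using smooth_seqI(2)[of "\<lambda>k x. c * (deriv ^^ k) f x" k,
      OF DERIV_cmult[OF smooth_has_derivs[OF f]]] by (simp add: fun_eq_iff)

lemma higher_deriv_sum:
  assumes f: "\<And>i. i \<in> A \<Longrightarrow> f i \<in> smooth_functions"
  shows "(deriv ^^ k) (\<lambda>x. \<Sum>i\<in>A. f i x) x = (\<Sum>i\<in>A. (deriv ^^ k) (f i) x)"
  using smooth_seqI(2)[of "\<lambda>k x. \<Sum>i\<in>A. (deriv ^^ k) (f i) x" k,
      OF DERIV_sum[OF smooth_has_derivs[OF f]]] by (simp add: fun_eq_iff)

lemma higher_deriv_affine:
  assumes f: "f \<in> smooth_functions"
  shows "(deriv ^^ k) (\<lambda>x. f (m * (x - c))) x = m ^ k * (deriv ^^ k) f (m * (x - c))"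
proof -
  have "((\<lambda>x. m ^ k * (deriv ^^ k) f (m * (x - c))) has_real_derivative
      m ^ Suc k * (deriv ^^ Suc k) f (m * (x - c))) (at x)" for k x
  proof -
    have "((\<lambda>x. m * (x - c)) has_real_derivative m) (at x)"
      by (auto intro!: derivative_eq_intros)
    from DERIV_cmult[OF DERIV_chain2[OF smooth_has_derivs[OF f] this], of "m ^ k" k]
    show ?thesis by (simp add: mult.assoc mult.commute[of m] del: funpow.simps)
  qed
  from smooth_seqI(2)[of "\<lambda>k x. m ^ k * (deriv ^^ k) f (m * (x - c))" k, OF this]
  show ?thesis by (simp add: fun_eq_iff)
qed

lemma smooth_continuous: "f \<in> smooth_functions \<Longrightarrow> continuous_on A ((deriv ^^ k) f)"
  by (meson DERIV_isCont continuous_at_imp_continuous_on smooth_has_derivs)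

lemma smooth_bounded:
  assumes "f \<in> smooth_functions" "compact A"
  obtains B where "B \<ge> 0" "\<And>x. x \<in> A \<Longrightarrow> \<bar>(deriv ^^ k) f x\<bar> \<le> B"
proof -
  have "bounded ((deriv ^^ k) f ` A)"
    using assms by (intro compact_imp_bounded compact_continuous_image smooth_continuous)
  then obtain B where "\<forall>x\<in>A. \<bar>(deriv ^^ k) f x\<bar> \<le> B" by (auto simp: bounded_iff)
  then show ?thesis by (intro that[of "max B 0"]) auto
qed

lemma higher_deriv_eq_on_open:
  assumes "open U" "\<And>x. x \<in> U \<Longrightarrow> f x = g x" "x \<in> U"
  shows "(deriv ^^ k) f x = (deriv ^^ k) g x"
  using assms(3)
proof (induction k arbitrary: x)
  case (Suc k)
  have "eventually (\<lambda>y. y \<in> U) (nhds x)"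
    using assms(1) Suc.prems by (rule eventually_nhds_in_open)
  then have "eventually (\<lambda>y. (deriv ^^ k) f y = (deriv ^^ k) g y) (nhds x)"
    by eventually_elim (rule Suc.IH)
  then show ?case by (simp add: deriv_cong_ev)
qed (use assms in simp)

section \<open>A smooth cutoff built from exp(-1/x)\<close>

definition flat_exp :: "real poly \<Rightarrow> real \<Rightarrow> real" where
  "flat_exp p x = (if x > 0 then poly p (1 / x) * exp (- (1 / x)) else 0)"

lemma poly_div_exp_tendsto_0: "((\<lambda>y. poly p y / exp y) \<longlongrightarrow> (0::real)) at_top"
proof -
  have "((\<lambda>y. \<Sum>i\<le>degree p. coeff p i * (y ^ i / exp y)) \<longlongrightarrow> (\<Sum>i\<le>degree p. coeff p i * 0)) at_top"
    by (intro tendsto_sum tendsto_mult tendsto_const tendsto_power_div_exp_0)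
  then show ?thesis by (simp add: poly_altdef sum_divide_distrib)
qed

text \<open>With s = 1/x, differentiation turns p(s) exp(-s) into s^2 (p(s) - p'(s)) exp(-s), so the
  family is closed under derivatives. At 0 the exponential beats every polynomial.\<close>

lemma flat_exp_has_derivative:
  "(flat_exp p has_real_derivative flat_exp ([:0, 0, 1:] * (p - pderiv p)) x) (at x)"
proof -
  consider "x > 0" | "x < 0" | "x = 0" by linarith
  then show ?thesis
  proof cases
    case 1
    have "((\<lambda>x. poly p (1 / x) * exp (- (1 / x))) has_real_derivative
        flat_exp ([:0, 0, 1:] * (p - pderiv p)) x) (at x)"
      using 1 by (auto intro!: derivative_eq_intros DERIV_chain2[OF poly_DERIV]
          simp: flat_exp_def field_simps power2_eq_square)
    then show ?thesis
      by (rule has_field_derivative_transform_within_open[of _ _ _ "{0<..}"])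
        (use 1 in \<open>auto simp: flat_exp_def\<close>)
  next
    case 2
    have "((\<lambda>x. 0) has_real_derivative flat_exp ([:0, 0, 1:] * (p - pderiv p)) x) (at x)"
      using 2 by (simp add: flat_exp_def)
    then show ?thesis
      by (rule has_field_derivative_transform_within_open[of _ _ _ "{..<0}"])
        (use 2 in \<open>auto simp: flat_exp_def\<close>)
  next
    case 3
    \<comment> \<open>The factor 1/h of the difference quotient is absorbed into the polynomial as
      \<open>pCons 0 p\<close>.\<close>
    have "((\<lambda>h. poly (pCons 0 p) (inverse h) / exp (inverse h)) \<longlongrightarrow> 0) (at_right (0::real))"
      by (rule filterlim_compose[OF poly_div_exp_tendsto_0 filterlim_inverse_at_top_right])
    then have "((\<lambda>h. flat_exp p h / h) \<longlongrightarrow> 0) (at_right 0)"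
      by (rule Lim_transform_eventually)
        (auto simp: eventually_at_right_less flat_exp_def field_simps exp_minus
          intro!: eventually_mono[OF eventually_at_right_less])
    moreover have "((\<lambda>h. flat_exp p h / h) \<longlongrightarrow> 0) (at_left 0)"
      by (rule Lim_transform_eventually[OF tendsto_const])
        (auto simp: flat_exp_def eventually_at_left[of "-1"] intro!: exI[of _ "-1"])
    ultimately have "((\<lambda>h. flat_exp p h / h) \<longlongrightarrow> 0) (at 0)"
      by (simp add: filterlim_at_split)
    then show ?thesis using 3 by (simp add: DERIV_def flat_exp_def)
  qed
qed

lemma flat_exp_smooth: "flat_exp p \<in> smooth_functions"
proof -
  have "ndifferentiable k (flat_exp p)" for k
    by (induction k arbitrary: p) (use flat_exp_has_derivative in fastforce)+
  then show ?thesis by (simp add: smooth_iff_ndifferentiable)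
qed

text \<open>The denominator is positive because x or 1 - x is; the quotient is 0 for x \<le> 0 and 1
  for x \<ge> 1.\<close>

definition smooth_step :: "real \<Rightarrow> real" where
  "smooth_step x = flat_exp 1 x / (flat_exp 1 x + flat_exp 1 (1 - x))"

lemma flat_exp_1: "flat_exp 1 x \<ge> 0" "flat_exp 1 x > 0 \<longleftrightarrow> x > 0"
  by (auto simp: flat_exp_def)

lemma smooth_step_smooth: "smooth_step \<in> smooth_functions"
proof -
  have "flat_exp 1 x + flat_exp 1 (1 - x) \<noteq> 0" for x
    using flat_exp_1[of x] flat_exp_1[of "1 - x"] by (cases "x > 0") linarith+
  then show ?thesis unfolding smooth_step_def
    by (intro smooth_divide smooth_add flat_exp_smooth
        smooth_compose[OF flat_exp_smooth] smooth_diff smooth_const smooth_ident)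
qed

definition cutoff :: "real \<Rightarrow> real" where
  "cutoff x = smooth_step (x + 1) * smooth_step (2 - x)"

lemma cutoff_smooth: "cutoff \<in> smooth_functions"
  unfolding cutoff_def
  by (intro smooth_mult smooth_compose[OF smooth_step_smooth] smooth_add smooth_diff
      smooth_const smooth_ident)

lemma cutoff_eq_1: "0 \<le> x \<Longrightarrow> x \<le> 1 \<Longrightarrow> cutoff x = 1"
  by (auto simp: cutoff_def smooth_step_def flat_exp_def)

lemma cutoff_eq_0: "x \<le> -1 \<or> x \<ge> 2 \<Longrightarrow> cutoff x = 0"
  by (auto simp: cutoff_def smooth_step_def flat_exp_def)

lemma cutoff_mult_bounded:
  assumes f: "f \<in> smooth_functions"
  obtains B where "B \<ge> 0" "\<And>x. \<bar>(deriv ^^ k) (\<lambda>x. cutoff x * f x) x\<bar> \<le> B"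
proof -
  obtain B where B: "B \<ge> 0" "\<And>x. x \<in> {-1..2} \<Longrightarrow> \<bar>(deriv ^^ k) (\<lambda>x. cutoff x * f x) x\<bar> \<le> B"
    by (rule smooth_bounded[OF smooth_mult[OF cutoff_smooth f] compact_Icc[of "-1" 2]]) blast
  have "(deriv ^^ k) (\<lambda>x. cutoff x * f x) x = 0" if "x \<notin> {-1..2}" for x
  proof -
    have "(deriv ^^ k) (\<lambda>x. cutoff x * f x) x = (deriv ^^ k) (\<lambda>x. 0 * f x) x"
      by (rule higher_deriv_eq_on_open[of "- {-1..2}"])
        (use that in \<open>auto simp: cutoff_eq_0 open_Compl\<close>)
    also have "\<dots> = 0" using higher_deriv_cmult[OF f, of k 0 x] by simp
    finally show ?thesis .
  qed
  then show ?thesis using B by (intro that[of B]) (metis abs_zero)+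
qed

section \<open>Whitney norms and seminorm topologies\<close>

lemma higher_deriv_taylor_poly:
  fixes c :: "nat \<Rightarrow> real" and y :: real
  shows taylor_poly_smooth: "(\<lambda>x. \<Sum>i\<le>q. c i * (x - y) ^ i / fact i) \<in> smooth_functions"
    and "k \<le> q \<Longrightarrow> (deriv ^^ k) (\<lambda>x. \<Sum>i\<le>q. c i * (x - y) ^ i / fact i) x
           = (\<Sum>j\<le>q - k. c (k + j) * (x - y) ^ j / fact j)"
proof -
  \<comment> \<open>Padding with zeros lets all derivatives be sums over the same range, so that
    differentiation is a shift of coefficients.\<close>
  define d where "d i = (if i \<le> q then c i else 0)" for i
  define D where "D k x = (\<Sum>j<Suc q. d (k + j) * ((x - y) ^ j / fact j))" for k x
  have D0: "(\<lambda>x. \<Sum>i\<le>q. c i * (x - y) ^ i / fact i) = D 0"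
    by (auto simp: D_def d_def lessThan_Suc_atMost intro!: sum.cong ext)
  have deriv: "(D k has_real_derivative D (Suc k) x) (at x)" for k x
  proof -
    have "(D k has_real_derivative
        (\<Sum>j<Suc q. d (k + j) * (real j * (x - y) ^ (j - 1) / fact j))) (at x)"
      unfolding D_def by (auto intro!: derivative_eq_intros sum.cong simp del: sum.lessThan_Suc)
    also have "(\<Sum>j<Suc q. d (k + j) * (real j * (x - y) ^ (j - 1) / fact j))
        = (\<Sum>j<q. d (Suc k + j) * ((x - y) ^ j / fact j))"
      by (subst sum.lessThan_Suc_shift)
        (auto intro!: sum.cong simp: field_simps simp del: sum.lessThan_Suc of_nat_Suc)
    also have "\<dots> = D (Suc k) x" by (simp add: D_def d_def)
    finally show ?thesis .
  qed
  show "(\<lambda>x. \<Sum>i\<le>q. c i * (x - y) ^ i / fact i) \<in> smooth_functions"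
    unfolding D0 by (rule smooth_seqI(1)[of D, OF deriv])
  assume k: "k \<le> q"
  have "(deriv ^^ k) (\<lambda>x. \<Sum>i\<le>q. c i * (x - y) ^ i / fact i) x = D k x"
    unfolding D0 using smooth_seqI(2)[of D, OF deriv] by simp
  also have "\<dots> = (\<Sum>j\<le>q - k. d (k + j) * ((x - y) ^ j / fact j))"
    unfolding D_def using k by (intro sum.mono_neutral_right) (auto simp: d_def)
  also have "\<dots> = (\<Sum>j\<le>q - k. c (k + j) * (x - y) ^ j / fact j)"
    using k by (intro sum.cong) (auto simp: d_def)
  finally show "(deriv ^^ k) (\<lambda>x. \<Sum>i\<le>q. c i * (x - y) ^ i / fact i) x
           = (\<Sum>j\<le>q - k. c (k + j) * (x - y) ^ j / fact j)" .
qed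

text \<open>The k-th derivative at x of the Taylor remainder of order q about y, computed from a
  smooth extension F; estimates can then avoid \<open>wderiv\<close>.\<close>

definition jet_rem :: "(real \<Rightarrow> real) \<Rightarrow> nat \<Rightarrow> nat \<Rightarrow> real \<Rightarrow> real \<Rightarrow> real" where
  "jet_rem F q k y x =
     (deriv ^^ k) F x - (\<Sum>j\<le>q - k. (deriv ^^ (k + j)) F y * (x - y) ^ j / fact j)"

definition jet_sup :: "real set \<Rightarrow> nat \<Rightarrow> (real \<Rightarrow> real) \<Rightarrow> real" where
  "jet_sup K q F = Sup {\<bar>(deriv ^^ k) F x\<bar> | k x. k \<le> q \<and> x \<in> K}"

definition rem_sup :: "real set \<Rightarrow> nat \<Rightarrow> (real \<Rightarrow> real) \<Rightarrow> real" where
  "rem_sup K q F = Sup {\<bar>jet_rem F q k y x\<bar> / \<bar>x - y\<bar> ^ (q - k) | x y k.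
     x \<in> K \<and> y \<in> K \<and> x \<noteq> y \<and> k \<le> q}"

lemma jet_rem_add:
  "F \<in> smooth_functions \<Longrightarrow> G \<in> smooth_functions \<Longrightarrow>
    jet_rem (\<lambda>x. F x + G x) q k y x = jet_rem F q k y x + jet_rem G q k y x"
  by (simp add: jet_rem_def higher_deriv_add distrib_right add_divide_distrib sum.distrib)

lemma wderiv_trace:
  "perfect_set K \<Longrightarrow> F \<in> smooth_functions \<Longrightarrow> x \<in> K \<Longrightarrow>
    wderiv K (trace_on K F) k x = (deriv ^^ k) F x"
  by (rule wderiv_eq) (auto simp: trace_on_def)

lemma wderiv_taylor_rem:
  assumes K: "perfect_set K" and F: "F \<in> smooth_functions" and xy: "x \<in> K" "y \<in> K" and k: "k \<le> q"
  shows "wderiv K (taylor_rem K (trace_on K F) q y) k x = jet_rem F q k y x"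
proof -
  let ?T = "\<lambda>x. \<Sum>i\<le>q. (deriv ^^ i) F y * (x - y) ^ i / fact i"
  have eq: "taylor_rem K (trace_on K F) q y = trace_on K (\<lambda>x. F x - ?T x)"
    using wderiv_trace[OF K F xy(2)] by (auto simp: taylor_rem_def taylor_def trace_on_def fun_eq_iff)
  have "wderiv K (taylor_rem K (trace_on K F) q y) k x = (deriv ^^ k) (\<lambda>x. F x - ?T x) x"
    unfolding eq using F by (intro wderiv_trace K xy smooth_diff taylor_poly_smooth)
  also have "\<dots> = jet_rem F q k y x"
    using higher_deriv_diff[OF F taylor_poly_smooth] higher_deriv_taylor_poly(2)[OF k]
    by (simp add: jet_rem_def)
  finally show ?thesis .
qed

lemma whitney_norm_eq:
  assumes K: "perfect_set K" and F: "F \<in> smooth_functions"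
  shows "whitney_norm K q (trace_on K F) = jet_sup K q F + rem_sup K q F"
proof -
  have "{\<bar>wderiv K (trace_on K F) k x\<bar> | k x. k \<le> q \<and> x \<in> K}
      = {\<bar>(deriv ^^ k) F x\<bar> | k x. k \<le> q \<and> x \<in> K}"
    using wderiv_trace[OF K F] by (intro Collect_cong ex_cong1) auto
  moreover have "{\<bar>wderiv K (taylor_rem K (trace_on K F) q y) k x\<bar> / \<bar>x - y\<bar> ^ (q - k) | x y k.
            x \<in> K \<and> y \<in> K \<and> x \<noteq> y \<and> k \<le> q}
      = {\<bar>jet_rem F q k y x\<bar> / \<bar>x - y\<bar> ^ (q - k) | x y k. x \<in> K \<and> y \<in> K \<and> x \<noteq> y \<and> k \<le> q}"
    using wderiv_taylor_rem[OF K F] by (intro Collect_cong ex_cong1) auto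
  ultimately show ?thesis
    by (simp add: whitney_norm_def deriv_sup_def jet_sup_def rem_sup_def)
qed

lemma smooth_jet_bounded:
  assumes "F \<in> smooth_functions" "compact A"
  obtains B where "B \<ge> 0" "\<And>k x. k \<le> q \<Longrightarrow> x \<in> A \<Longrightarrow> \<bar>(deriv ^^ k) F x\<bar> \<le> B"
proof -
  have "\<exists>B\<ge>0. \<forall>x\<in>A. \<bar>(deriv ^^ k) F x\<bar> \<le> B" for k
    by (rule smooth_bounded[OF assms]) blast
  then obtain B where B: "\<And>k. B k \<ge> 0" "\<And>k x. x \<in> A \<Longrightarrow> \<bar>(deriv ^^ k) F x\<bar> \<le> B k" by metis
  have "B k \<le> (\<Sum>k\<le>q. B k)" if "k \<le> q" for k
    using that B(1) by (intro member_le_sum) auto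
  then show ?thesis using B
    by (intro that[of "\<Sum>k\<le>q. B k"]) (blast intro: sum_nonneg order_trans)+
qed

lemma jet_rem_taylor:
  assumes F: "F \<in> smooth_functions" and kq: "k \<le> q" and xy: "x \<noteq> y" "x \<in> {a..b}" "y \<in> {a..b}"
  obtains t where "t \<in> {a..b}"
    "jet_rem F q k y x = (deriv ^^ Suc q) F t / fact (Suc (q - k)) * (x - y) ^ Suc (q - k)"
proof -
  have "\<exists>t. (if x < y then x < t \<and> t < y else y < t \<and> t < x) \<and>
      (deriv ^^ k) F x = (\<Sum>m<Suc (q - k). (deriv ^^ (k + m)) F y / fact m * (x - y) ^ m)
        + (deriv ^^ (k + Suc (q - k))) F t / fact (Suc (q - k)) * (x - y) ^ Suc (q - k)"
    by (rule Taylor[where a=a and b=b and diff="\<lambda>m. (deriv ^^ (k + m)) F"])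
      (use xy smooth_has_derivs[OF F] in auto)
  then obtain t where t: "if x < y then x < t \<and> t < y else y < t \<and> t < x"
    "(deriv ^^ k) F x = (\<Sum>m<Suc (q - k). (deriv ^^ (k + m)) F y / fact m * (x - y) ^ m)
        + (deriv ^^ (k + Suc (q - k))) F t / fact (Suc (q - k)) * (x - y) ^ Suc (q - k)"
    by blast
  show ?thesis
  proof (rule that[of t])
    show "t \<in> {a..b}" using t(1) xy by (auto split: if_splits)
    have "k + Suc (q - k) = Suc q" using kq by simp
    then show "jet_rem F q k y x = (deriv ^^ Suc q) F t / fact (Suc (q - k)) * (x - y) ^ Suc (q - k)"
      unfolding jet_rem_def using t(2)
      by (simp add: lessThan_Suc_atMost del: funpow.simps power_Suc fact_Suc sum.lessThan_Suc)
  qed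
qed

text \<open>The Lagrange remainder carries q - k + 1 factors x - y; one of them is estimated by the
  length of the interval.\<close>

lemma jet_rem_le:
  assumes F: "F \<in> smooth_functions" and kq: "k \<le> q" and xy: "x \<in> {a..b}" "y \<in> {a..b}" "x \<noteq> y"
    and B: "\<And>t. t \<in> {a..b} \<Longrightarrow> \<bar>(deriv ^^ Suc q) F t\<bar> \<le> B"
  shows "\<bar>jet_rem F q k y x\<bar> \<le> B * (b - a) * \<bar>x - y\<bar> ^ (q - k)"
proof -
  obtain t where t: "t \<in> {a..b}"
    "jet_rem F q k y x = (deriv ^^ Suc q) F t / fact (Suc (q - k)) * (x - y) ^ Suc (q - k)"
    using jet_rem_taylor[OF F kq xy(3,1,2)] by blast
  have B0: "0 \<le> B" using B[OF t(1)] by linarith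
  have "\<bar>(deriv ^^ Suc q) F t / fact (Suc (q - k))\<bar> \<le> B / 1"
    unfolding abs_divide using B[OF t(1)] B0 by (intro frac_le) (auto simp: fact_ge_1 simp del: fact_Suc)
  moreover have "\<bar>(x - y) ^ Suc (q - k)\<bar> \<le> (b - a) * \<bar>x - y\<bar> ^ (q - k)"
    using xy by (auto simp: abs_mult power_abs intro!: mult_right_mono)
  ultimately have "\<bar>jet_rem F q k y x\<bar> \<le> B / 1 * ((b - a) * \<bar>x - y\<bar> ^ (q - k))"
    unfolding t(2) abs_mult by (intro mult_mono) (use B0 in auto)
  then show ?thesis by (simp add: mult.assoc)
qed

lemma perfect_setI:
  assumes "closed K" "\<And>x. x \<in> K \<Longrightarrow> x islimpt K"
  shows "perfect_set K"
  using assms by (auto simp: perfect_set_def closed_limpt)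

section \<open>Whitney norms on a perfect compact set\<close>

locale perfect_compact =
  fixes K :: "real set"
  assumes perf: "perfect_set K" and comp: "compact K" and nonempty: "K \<noteq> {}"
begin

lemma other_point: "x \<in> K \<Longrightarrow> \<exists>y\<in>K. y \<noteq> x"
proof -
  assume "x \<in> K"
  then have "x islimpt K" using perf by (auto simp: perfect_set_def)
  then show ?thesis by (auto simp: islimpt_def)
qed

lemma jet_sup_bdd:
  assumes F: "F \<in> smooth_functions"
  shows "bdd_above {\<bar>(deriv ^^ k) F x\<bar> | k x. k \<le> q \<and> x \<in> K}"
proof -
  obtain B where "\<And>k x. k \<le> q \<Longrightarrow> x \<in> K \<Longrightarrow> \<bar>(deriv ^^ k) F x\<bar> \<le> B"
    by (rule smooth_jet_bounded[OF F comp]) blast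
  then show ?thesis by (intro bdd_aboveI[of _ B]) auto
qed

lemma rem_sup_bdd:
  assumes F: "F \<in> smooth_functions"
  shows "bdd_above {\<bar>jet_rem F q k y x\<bar> / \<bar>x - y\<bar> ^ (q - k) | x y k.
     x \<in> K \<and> y \<in> K \<and> x \<noteq> y \<and> k \<le> q}"
proof -
  obtain a where a: "K \<subseteq> {-a..a}"
    using compact_imp_bounded[OF comp] by (auto simp: bounded_iff abs_le_iff minus_le_iff subset_eq)
  obtain B where B: "\<And>t. t \<in> {-a..a} \<Longrightarrow> \<bar>(deriv ^^ Suc q) F t\<bar> \<le> B"
    by (rule smooth_bounded[OF F compact_Icc[of "-a" a], of "Suc q"]) blast
  show ?thesis
  proof (rule bdd_aboveI[of _ "B * (a - -a)"])
    fix r assume "r \<in> {\<bar>jet_rem F q k y x\<bar> / \<bar>x - y\<bar> ^ (q - k) | x y k.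
       x \<in> K \<and> y \<in> K \<and> x \<noteq> y \<and> k \<le> q}"
    then obtain x y k where r: "r = \<bar>jet_rem F q k y x\<bar> / \<bar>x - y\<bar> ^ (q - k)"
      "x \<in> K" "y \<in> K" "x \<noteq> y" "k \<le> q" by blast
    have "\<bar>jet_rem F q k y x\<bar> \<le> B * (a - -a) * \<bar>x - y\<bar> ^ (q - k)"
      using r a B by (intro jet_rem_le F) auto
    then show "r \<le> B * (a - -a)" unfolding r(1) using r(4) by (simp add: divide_le_eq)
  qed
qed

lemma jet_sup_upper:
  "F \<in> smooth_functions \<Longrightarrow> k \<le> q \<Longrightarrow> x \<in> K \<Longrightarrow> \<bar>(deriv ^^ k) F x\<bar> \<le> jet_sup K q F"
  unfolding jet_sup_def by (rule cSup_upper[OF _ jet_sup_bdd]) auto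

lemma rem_sup_upper:
  assumes "F \<in> smooth_functions" "k \<le> q" "x \<in> K" "y \<in> K" "x \<noteq> y"
  shows "\<bar>jet_rem F q k y x\<bar> \<le> rem_sup K q F * \<bar>x - y\<bar> ^ (q - k)"
proof -
  have "\<bar>jet_rem F q k y x\<bar> / \<bar>x - y\<bar> ^ (q - k) \<le> rem_sup K q F"
    unfolding rem_sup_def by (rule cSup_upper[OF _ rem_sup_bdd]) (use assms in auto)
  then show ?thesis using assms(5) by (simp add: divide_le_eq)
qed

lemma jet_sup_nonneg: "F \<in> smooth_functions \<Longrightarrow> 0 \<le> jet_sup K q F"
  using jet_sup_upper[of F 0 q] nonempty by (meson abs_ge_zero all_not_in_conv le0 order_trans)

lemma rem_sup_nonneg: "F \<in> smooth_functions \<Longrightarrow> 0 \<le> rem_sup K q F"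
proof -
  assume F: "F \<in> smooth_functions"
  obtain x y where "x \<in> K" "y \<in> K" "x \<noteq> y" using other_point nonempty by blast
  from rem_sup_upper[OF F le_refl this, of q] show ?thesis by simp
qed

lemma whitney_norm_le:
  assumes F: "F \<in> smooth_functions"
    and A: "\<And>k x. k \<le> q \<Longrightarrow> x \<in> K \<Longrightarrow> \<bar>(deriv ^^ k) F x\<bar> \<le> A"
    and B: "\<And>k x y. k \<le> q \<Longrightarrow> x \<in> K \<Longrightarrow> y \<in> K \<Longrightarrow> x \<noteq> y \<Longrightarrow>
             \<bar>jet_rem F q k y x\<bar> \<le> B * \<bar>x - y\<bar> ^ (q - k)"
  shows "whitney_norm K q (trace_on K F) \<le> A + B"
  unfolding whitney_norm_eq[OF perf F] jet_sup_def rem_sup_def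
proof (intro add_mono cSup_least)
  show "{\<bar>(deriv ^^ k) F x\<bar> | k x. k \<le> q \<and> x \<in> K} \<noteq> {}" using nonempty by auto
  obtain x y where "x \<in> K" "y \<in> K" "x \<noteq> y" using other_point nonempty by blast
  then show "{\<bar>jet_rem F q k y x\<bar> / \<bar>x - y\<bar> ^ (q - k) | x y k.
     x \<in> K \<and> y \<in> K \<and> x \<noteq> y \<and> k \<le> q} \<noteq> {}" by blast
qed (use A B in \<open>auto simp: divide_le_eq\<close>)

lemma whitney_norm_upper:
  assumes "F \<in> smooth_functions" "k \<le> q" "x \<in> K"
  shows "\<bar>(deriv ^^ k) F x\<bar> \<le> whitney_norm K q (trace_on K F)"
  using jet_sup_upper[OF assms] rem_sup_nonneg[OF assms(1), of q] whitney_norm_eq[OF perf assms(1)]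
  by (simp add: add_increasing2)

text \<open>The diagonal, where the remainder vanishes, is included so that a base point may itself
  be an interpolation node.\<close>

lemma whitney_norm_upper_rem:
  assumes F: "F \<in> smooth_functions" and k: "k \<le> q" and xy: "x \<in> K" "y \<in> K"
  shows "\<bar>jet_rem F q k y x\<bar> \<le> whitney_norm K q (trace_on K F) * \<bar>x - y\<bar> ^ (q - k)"
proof (cases "x = y")
  case True
  then show ?thesis
    using jet_sup_nonneg[OF F, of q] rem_sup_nonneg[OF F, of q]
    by (simp add: jet_rem_def whitney_norm_eq[OF perf F] sum.atMost_shift zero_power)
next
  case False
  have "\<bar>jet_rem F q k y x\<bar> \<le> rem_sup K q F * \<bar>x - y\<bar> ^ (q - k)"
    by (rule rem_sup_upper[OF F k xy False])
  also have "\<dots> \<le> whitney_norm K q (trace_on K F) * \<bar>x - y\<bar> ^ (q - k)"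
    using jet_sup_nonneg[OF F, of q] by (intro mult_right_mono) (auto simp: whitney_norm_eq[OF perf F])
  finally show ?thesis .
qed

lemma whitney_functionsE:
  assumes "f \<in> whitney_functions K"
  obtains F where "F \<in> smooth_functions" "f = trace_on K F"
  using assms by (auto simp: whitney_functions_def)

lemma trace_on_whitney: "F \<in> smooth_functions \<Longrightarrow> trace_on K F \<in> whitney_functions K"
  by (auto simp: whitney_functions_def)

lemma whitney_functions_add:
  "f \<in> whitney_functions K \<Longrightarrow> g \<in> whitney_functions K \<Longrightarrow> (\<lambda>x. f x + g x) \<in> whitney_functions K"
proof (elim whitney_functionsE)
  fix F G assume *: "F \<in> smooth_functions" "G \<in> smooth_functions" "f = trace_on K F" "g = trace_on K G"
  then have "(\<lambda>x. f x + g x) = trace_on K (\<lambda>x. F x + G x)" by (auto simp: trace_on_def)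
  then show ?thesis using * by (simp add: trace_on_whitney smooth_add)
qed

lemma whitney_functions_cmult:
  "f \<in> whitney_functions K \<Longrightarrow> (\<lambda>x. c * f x) \<in> whitney_functions K"
proof (elim whitney_functionsE)
  fix F assume *: "F \<in> smooth_functions" "f = trace_on K F"
  then have "(\<lambda>x. c * f x) = trace_on K (\<lambda>x. c * F x)" by (auto simp: trace_on_def)
  then show ?thesis using * by (simp add: trace_on_whitney smooth_mult)
qed

lemma whitney_functions_diff:
  "f \<in> whitney_functions K \<Longrightarrow> g \<in> whitney_functions K \<Longrightarrow> (\<lambda>x. f x - g x) \<in> whitney_functions K"
  using whitney_functions_add[of f "\<lambda>x. (-1) * g x"] whitney_functions_cmult[of g "-1"] by simp

lemma whitney_norm_add:
  assumes "f \<in> whitney_functions K" "g \<in> whitney_functions K"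
  shows "whitney_norm K q (\<lambda>x. f x + g x) \<le> whitney_norm K q f + whitney_norm K q g"
proof -
  obtain F G where F: "F \<in> smooth_functions" "f = trace_on K F"
    and G: "G \<in> smooth_functions" "g = trace_on K G" using assms by (elim whitney_functionsE)
  have eq: "(\<lambda>x. f x + g x) = trace_on K (\<lambda>x. F x + G x)" using F G by (auto simp: trace_on_def)
  have "whitney_norm K q (trace_on K (\<lambda>x. F x + G x))
      \<le> (jet_sup K q F + jet_sup K q G) + (rem_sup K q F + rem_sup K q G)"
  proof (rule whitney_norm_le)
    fix k x assume "k \<le> q" "x \<in> K"
    then show "\<bar>(deriv ^^ k) (\<lambda>x. F x + G x) x\<bar> \<le> jet_sup K q F + jet_sup K q G"
      unfolding higher_deriv_add[OF F(1) G(1)]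
      using jet_sup_upper[OF F(1)] jet_sup_upper[OF G(1)] by (meson abs_triangle_ineq add_mono order_trans)
  next
    fix k x y assume *: "k \<le> q" "x \<in> K" "y \<in> K" "x \<noteq> y"
    show "\<bar>jet_rem (\<lambda>x. F x + G x) q k y x\<bar> \<le> (rem_sup K q F + rem_sup K q G) * \<bar>x - y\<bar> ^ (q - k)"
      unfolding jet_rem_add[OF F(1) G(1)] distrib_right
      using rem_sup_upper[OF F(1) *] rem_sup_upper[OF G(1) *] by linarith
  qed (use F G in auto)
  then show ?thesis
    unfolding eq by (simp add: F(2) G(2) whitney_norm_eq[OF perf F(1)] whitney_norm_eq[OF perf G(1)])
qed

lemma whitney_norm_nonneg: "f \<in> whitney_functions K \<Longrightarrow> 0 \<le> whitney_norm K q f"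
  by (elim whitney_functionsE)
    (auto simp: whitney_norm_eq[OF perf] intro!: add_nonneg_nonneg jet_sup_nonneg rem_sup_nonneg)

lemma whitney_norm_0: "whitney_norm K q (\<lambda>x. 0) = 0"
proof -
  have 1: "(\<lambda>x. 0) = trace_on K (\<lambda>x. 0)" by (auto simp: trace_on_def)
  have z: "(deriv ^^ k) (\<lambda>x. 0::real) x = 0" for k x
    using higher_deriv_cmult[OF smooth_const[of 0], of k 0 x] by simp
  have "whitney_norm K q (\<lambda>x. 0) \<le> 0 + 0"
    by (subst 1, rule whitney_norm_le) (auto simp: z jet_rem_def)
  moreover have "whitney_norm K q (\<lambda>x. 0) \<ge> 0"
    by (subst 1, intro whitney_norm_nonneg trace_on_whitney smooth_const)
  ultimately show ?thesis by simp
qed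

end

section \<open>Seminorms of smooth functions and continuity in seminorm topologies\<close>

lemma smooth_seminorm_upper:
  assumes "F \<in> smooth_functions" "k \<le> p" "\<bar>x\<bar> \<le> real p"
  shows "\<bar>(deriv ^^ k) F x\<bar> \<le> smooth_seminorm p F"
proof -
  obtain B where "\<And>k x. k \<le> p \<Longrightarrow> x \<in> {-real p..real p} \<Longrightarrow> \<bar>(deriv ^^ k) F x\<bar> \<le> B"
    by (rule smooth_jet_bounded[OF assms(1) compact_Icc]) blast
  then have "bdd_above {\<bar>(deriv ^^ k) F x\<bar> | k x. k \<le> p \<and> x \<in> {-real p..real p}}"
    by (intro bdd_aboveI[of _ B]) auto
  then show ?thesis unfolding smooth_seminorm_def deriv_sup_def
    using assms by (intro cSup_upper CollectI exI[of _ k] exI[of _ x]) auto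
qed

lemma smooth_seminorm_le:
  assumes "\<And>k x. k \<le> p \<Longrightarrow> \<bar>x\<bar> \<le> real p \<Longrightarrow> \<bar>(deriv ^^ k) F x\<bar> \<le> B"
  shows "smooth_seminorm p F \<le> B"
  unfolding smooth_seminorm_def deriv_sup_def
  using assms by (intro cSup_least) (auto intro!: exI[of _ 0])

lemma smooth_seminorm_add:
  assumes "F \<in> smooth_functions" "G \<in> smooth_functions"
  shows "smooth_seminorm p (\<lambda>x. F x + G x) \<le> smooth_seminorm p F + smooth_seminorm p G"
  using smooth_seminorm_upper[OF assms(1)] smooth_seminorm_upper[OF assms(2)]
  by (intro smooth_seminorm_le) (auto simp: higher_deriv_add[OF assms]
      intro!: order_trans[OF abs_triangle_ineq] add_mono)

lemma smooth_seminorm_0: "smooth_seminorm p (\<lambda>x. 0) = 0"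
proof -
  have z: "(deriv ^^ k) (\<lambda>x. 0::real) x = 0" for k x
    using higher_deriv_cmult[OF smooth_const[of 0], of k 0 x] by simp
  show ?thesis
    using smooth_seminorm_le[of p "\<lambda>x. 0" 0] smooth_seminorm_upper[of "\<lambda>x. 0" 0 p 0]
    by (simp add: z)
qed

text \<open>Subbasic balls have arbitrary centres; the triangle inequality fits a ball about f into
  each of them, and finite intersections take the maximal order and the minimal radius. All orders
  up to Q enter, as the seminorms need not increase with q.\<close>

lemma seminorm_topology_nbhd:
  assumes add: "\<And>q f g. f \<in> V \<Longrightarrow> g \<in> V \<Longrightarrow> N q (\<lambda>x. f x + g x) \<le> N q f + N q g"
    and diff: "\<And>f g. f \<in> V \<Longrightarrow> g \<in> V \<Longrightarrow> (\<lambda>x. f x - g x) \<in> V"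
    and U: "openin (seminorm_topology V N) U" and f: "f \<in> U" "f \<in> V"
  shows "\<exists>Q. \<exists>e>0. \<forall>g\<in>V. (\<forall>q\<le>Q. N q (\<lambda>x. g x - f x) < e) \<longrightarrow> g \<in> U"
proof -
  have "generate_topology_on {{g \<in> V. N q (\<lambda>x. g x - f x) < e} | q f e. f \<in> V \<and> 0 < e} U"
    using U by (simp add: seminorm_topology_def openin_topology_generated_by_iff)
  then show ?thesis using f(1)
  proof induction
    case Empty
    then show ?case by simp
  next
    case (Int A B)
    then obtain Q e Q' e' where *: "e > 0" "e' > 0"
      "\<forall>g\<in>V. (\<forall>q\<le>Q. N q (\<lambda>x. g x - f x) < e) \<longrightarrow> g \<in> A"
      "\<forall>g\<in>V. (\<forall>q\<le>Q'. N q (\<lambda>x. g x - f x) < e') \<longrightarrow> g \<in> B" by auto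
    then show ?case
      by (intro exI[of _ "max Q Q'"] exI[of _ "min e e'"]) auto
  next
    case (UN \<U>)
    then show ?case by (meson UnionE UnionI)
  next
    case (Basis A)
    then obtain q g e where A: "A = {h \<in> V. N q (\<lambda>x. h x - g x) < e}" "g \<in> V" "0 < e" by blast
    show ?case
    proof (intro exI[of _ q] exI[of _ "e - N q (\<lambda>x. f x - g x)"] conjI ballI impI)
      show "0 < e - N q (\<lambda>x. f x - g x)" using A Basis by auto
      fix h assume h: "h \<in> V" "\<forall>q'\<le>q. N q' (\<lambda>x. h x - f x) < e - N q (\<lambda>x. f x - g x)"
      have "N q (\<lambda>x. h x - g x) = N q (\<lambda>x. (h x - f x) + (f x - g x))" by simp
      also have "\<dots> \<le> N q (\<lambda>x. h x - f x) + N q (\<lambda>x. f x - g x)"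
        using h f A by (intro add diff)
      also have "\<dots> < e" using h(2) by (metis le_refl less_diff_eq)
      finally show "h \<in> A" using A h by simp
    qed
  qed
qed

text \<open>Since W respects differences, a bound of each target seminorm by one source seminorm
  puts a ball about every point of the preimage of a ball inside that preimage.\<close>

lemma continuous_map_seminorm_topology:
  assumes W: "W \<in> V \<rightarrow> V'"
    and diff: "\<And>f g. f \<in> V \<Longrightarrow> g \<in> V \<Longrightarrow> (\<lambda>x. f x - g x) \<in> V"
    and diff': "\<And>f g. f \<in> V' \<Longrightarrow> g \<in> V' \<Longrightarrow> (\<lambda>x. f x - g x) \<in> V'"
    and Wdiff: "\<And>f g. f \<in> V \<Longrightarrow> g \<in> V \<Longrightarrow> W (\<lambda>x. f x - g x) = (\<lambda>x. W f x - W g x)"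
    and N0: "\<And>q. N q (\<lambda>x. 0) = 0" and nonneg: "\<And>q f. f \<in> V \<Longrightarrow> 0 \<le> N q f"
    and N'0: "\<And>q. N' q (\<lambda>x. 0) = 0"
    and add': "\<And>q f g. f \<in> V' \<Longrightarrow> g \<in> V' \<Longrightarrow> N' q (\<lambda>x. f x + g x) \<le> N' q f + N' q g"
    and bound: "\<And>p. \<exists>q C. \<forall>f\<in>V. N' p (W f) \<le> C * N q f"
  shows "continuous_map (seminorm_topology V N) (seminorm_topology V' N') W"
proof -
  let ?S = "{{g \<in> V'. N' q (\<lambda>x. g x - f x) < e} | q f e. f \<in> V' \<and> 0 < e}"
  have top: "topspace (seminorm_topology V N) = V" "topspace (seminorm_topology V' N') = V'"
    by (simp_all add: topspace_seminorm_topology N0 N'0)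
  have "openin (seminorm_topology V N) (W -` U \<inter> V)" if U': "U \<in> ?S" for U
  proof -
    obtain p G e where U: "U = {g \<in> V'. N' p (\<lambda>x. g x - G x) < e}" "G \<in> V'" "0 < e"
      using U' by blast
    obtain q C where C: "\<And>f. f \<in> V \<Longrightarrow> N' p (W f) \<le> C * N q f" using bound by blast
    have "\<exists>T. openin (seminorm_topology V N) T \<and> f \<in> T \<and> T \<subseteq> W -` U \<inter> V" if f: "f \<in> W -` U \<inter> V" for f
    proof -
      \<comment> \<open>The divisor is positive whatever the sign of C.\<close>
      define r where "r = (e - N' p (\<lambda>x. W f x - G x)) / (\<bar>C\<bar> + 1)"
      have fV: "f \<in> V" and Wf: "W f \<in> V'" using f W by auto
      have r: "r > 0" unfolding r_def using f U by auto
      let ?T = "{g \<in> V. N q (\<lambda>x. g x - f x) < r}"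
      have "openin (seminorm_topology V N) ?T"
        unfolding seminorm_topology_def
        by (rule topology_generated_by_Basis) (use fV r in blast)
      moreover have "f \<in> ?T" using fV r N0 by simp
      moreover have "?T \<subseteq> W -` U \<inter> V"
      proof
        fix g assume g: "g \<in> ?T"
        have gV: "g \<in> V" and Wg: "W g \<in> V'" using g W by auto
        have "C * N q (\<lambda>x. g x - f x) \<le> (\<bar>C\<bar> + 1) * N q (\<lambda>x. g x - f x)" if "N q (\<lambda>x. g x - f x) \<ge> 0"
          using that by (intro mult_right_mono) auto
        moreover have "N' p (W (\<lambda>x. g x - f x)) \<le> C * N q (\<lambda>x. g x - f x)"
          using C diff gV fV by blast
        moreover have "N q (\<lambda>x. g x - f x) \<ge> 0"
          using diff gV fV by (rule_tac nonneg) blast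
        moreover have "(\<bar>C\<bar> + 1) * N q (\<lambda>x. g x - f x) < (\<bar>C\<bar> + 1) * r"
          using g by (intro mult_strict_left_mono) auto
        moreover have "(\<bar>C\<bar> + 1) * r = e - N' p (\<lambda>x. W f x - G x)" by (simp add: r_def add_pos_nonneg)
        ultimately have "N' p (W (\<lambda>x. g x - f x)) < e - N' p (\<lambda>x. W f x - G x)" by linarith
        moreover have "N' p (\<lambda>x. W g x - G x) \<le> N' p (\<lambda>x. W g x - W f x) + N' p (\<lambda>x. W f x - G x)"
          using add'[OF diff'[OF Wg Wf] diff'[OF Wf U(2)]] by simp
        ultimately show "g \<in> W -` U \<inter> V"
          using U gV Wg Wdiff[OF gV fV] by auto
      qed
      ultimately show ?thesis by blast
    qed
    then show ?thesis using openin_subopen by blast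
  qed
  moreover have "W ` V \<subseteq> \<Union>?S"
    using W top(2) unfolding seminorm_topology_def topology_generated_by_topspace by blast
  ultimately show ?thesis
    unfolding seminorm_topology_def[of V'] continuous_on_generated_topo_iff top(1) by blast
qed

section \<open>Bounds for Hausdorff measures\<close>

text \<open>Covers are countable sets, not sequences, so countable subadditivity is carried to
  \<open>infsum\<close> along an enumeration.\<close>

lemma emeasure_UN_le_infsum:
  assumes I: "countable I" and J: "\<And>i. i \<in> I \<Longrightarrow> J i \<in> sets M"
  shows "emeasure M (\<Union>i\<in>I. J i) \<le> (\<Sum>\<^sub>\<infinity>i\<in>I. emeasure M (J i))"
proof (cases "finite I")
  case True
  then show ?thesis using J by (simp add: emeasure_subadditive_finite image_subset_iff)
next
  case False
  define e where "e = from_nat_into I"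
  have e: "bij_betw e UNIV I"
    unfolding e_def using I False by (rule bij_betw_from_nat_into)
  have "emeasure M (\<Union>i\<in>I. J i) = emeasure M (\<Union>n. J (e n))"
    using e by (metis bij_betw_imp_surj_on image_image)
  also have "\<dots> \<le> (\<Sum>n. emeasure M (J (e n)))"
    using e J by (intro emeasure_subadditive_countably) (auto dest: bij_betwE)
  also have "\<dots> \<le> (\<Sum>\<^sub>\<infinity>i\<in>I. emeasure M (J i))"
  proof (rule suminf_le_const[OF summableI])
    fix n
    have "inj_on e {..<n}" using e by (metis bij_betw_imp_inj_on inj_on_subset subset_UNIV)
    then have "(\<Sum>i<n. emeasure M (J (e i))) = (\<Sum>i\<in>e ` {..<n}. emeasure M (J i))"
      by (simp add: sum.reindex)
    also have "\<dots> = (\<Sum>\<^sub>\<infinity>i\<in>e ` {..<n}. emeasure M (J i))" by simp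
    also have "\<dots> \<le> (\<Sum>\<^sub>\<infinity>i\<in>I. emeasure M (J i))"
      using e by (intro infsum_mono_neutral nonneg_summable_on_complete) (auto dest: bij_betwE)
    finally show "(\<Sum>i<n. emeasure M (J (e i))) \<le> (\<Sum>\<^sub>\<infinity>i\<in>I. emeasure M (J i))" .
  qed
  finally show ?thesis .
qed

lemma interval_length:
  assumes "(\<exists>a b::real. a < b \<and> (G = {a<..<b} \<or> G = {a..b}))" "u \<in> G" "v \<in> G"
  shows "\<bar>u - v\<bar> \<le> measure lborel G"
  using assms by auto

text \<open>A negative radius gives the empty interval and \<open>ennreal\<close> truncates
  accordingly, so the formula holds for both signs.\<close>

lemma emeasure_lborel_centered: "emeasure lborel {u - r..u + r :: real} = ennreal (2 * r)"
  by (cases "r \<ge> 0") (auto simp: ennreal_neg)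

text \<open>The mass distribution principle, for a set given by a parametrisation \<open>x\<close>; the mass
  is the Lebesgue measure carried over by \<open>b\<close>.\<close>

lemma hausdorff_measure_pos:
  fixes h :: "real \<Rightarrow> real" and x b :: "'a \<Rightarrow> real"
  assumes mono: "\<And>s t. 0 \<le> s \<Longrightarrow> s \<le> t \<Longrightarrow> h s \<le> h t"
    and x: "x ` S \<subseteq> K" and b: "{c..<d} \<subseteq> b ` S" and cd: "c < d" and C: "C > 0"
    and bx: "\<And>s t. s \<in> S \<Longrightarrow> t \<in> S \<Longrightarrow> \<bar>b s - b t\<bar> \<le> C * h \<bar>x s - x t\<bar>"
  shows "0 < hausdorff_measure h K"
proof -
  \<comment> \<open>Scaled so that an interval of radius C times h of the length of G has mass h of
    that length.\<close>
  define \<mu> where "\<mu> = scale_measure (ennreal (1 / (2 * C))) (lborel :: real measure)"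
  have lower: "ennreal ((d - c) / (2 * C)) \<le> hausdorff_content h 1 K"
    unfolding hausdorff_content_def
  proof (rule INF_greatest)
    fix \<G> assume "\<G> \<in> interval_covers 1 K"
    then have \<G>: "countable \<G>" "K \<subseteq> \<Union>\<G>"
      and len: "\<And>G. G \<in> \<G> \<Longrightarrow> \<exists>a b. a < b \<and> (G = {a<..<b} \<or> G = {a..b})"
      unfolding interval_covers_def by auto
    \<comment> \<open>The centre is the image of some parameter whose point lies in G. If there is
      none, the choice is arbitrary but the mass of \<open>J G\<close> is the same.\<close>
    define J where "J G = (let r = C * h (measure lborel G); s = SOME s. s \<in> S \<and> x s \<in> G
      in {b s - r..b s + r})" for G
    have "{c..<d} \<subseteq> (\<Union>G\<in>\<G>. J G)"
    proof
      fix t assume "t \<in> {c..<d}"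
      then obtain s where s: "s \<in> S" "t = b s" using b by blast
      then obtain G where G: "G \<in> \<G>" "x s \<in> G" using x \<G>(2) by blast
      define s' where "s' = (SOME s. s \<in> S \<and> x s \<in> G)"
      have s': "s' \<in> S" "x s' \<in> G" unfolding s'_def using s G by (metis (mono_tags, lifting) someI)+
      have "\<bar>b s - b s'\<bar> \<le> C * h \<bar>x s - x s'\<bar>" using bx s s' by blast
      also have "\<dots> \<le> C * h (measure lborel G)"
        using C interval_length[OF len[OF G(1)] G(2) s'(2)] by (intro mult_left_mono mono) auto
      finally have "t \<in> J G" by (auto simp: J_def s(2) s'_def[symmetric] Let_def abs_le_iff)
      then show "t \<in> (\<Union>G\<in>\<G>. J G)" using G by blast
    qed
    moreover have J_sets: "J G \<in> sets \<mu>" for G by (simp add: J_def \<mu>_def Let_def)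
    ultimately have "emeasure \<mu> {c..<d} \<le> emeasure \<mu> (\<Union>G\<in>\<G>. J G)"
      using \<G>(1) by (intro emeasure_mono) (auto intro: sets.countable_UN')
    also have "\<dots> \<le> (\<Sum>\<^sub>\<infinity>G\<in>\<G>. emeasure \<mu> (J G))"
      by (rule emeasure_UN_le_infsum[OF \<G>(1) J_sets])
    also have "\<dots> \<le> (\<Sum>\<^sub>\<infinity>G\<in>\<G>. ennreal (h (measure lborel G)))"
    proof (rule infsum_mono)
      fix G
      have "emeasure \<mu> (J G) = ennreal (1 / (2 * C)) * ennreal (2 * C * h (measure lborel G))"
        by (simp add: \<mu>_def J_def Let_def emeasure_lborel_centered mult.assoc)
      also have "\<dots> = ennreal (h (measure lborel G))"
        using C by (simp flip: ennreal_mult')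
      finally show "emeasure \<mu> (J G) \<le> ennreal (h (measure lborel G))" by simp
    qed (simp_all add: nonneg_summable_on_complete)
    also have "emeasure \<mu> {c..<d} = ennreal ((d - c) / (2 * C))"
      using C cd by (simp add: \<mu>_def flip: ennreal_mult')
    finally show "ennreal ((d - c) / (2 * C)) \<le> (\<Sum>\<^sub>\<infinity>G\<in>\<G>. ennreal (h (measure lborel G)))" .
  qed
  have "0 < ennreal ((d - c) / (2 * C))" using C cd by simp
  also have "\<dots> \<le> hausdorff_content h 1 K" by (rule lower)
  also have "\<dots> \<le> hausdorff_measure h K"
    unfolding hausdorff_measure_eq_SUP by (rule SUP_upper) simp
  finally show ?thesis .
qed

text \<open>Arbitrarily fine covers of total h-value at most C bound every content by C; intervals
  of equal length suffice for both sets.\<close>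

lemma hausdorff_measure_finite:
  fixes h :: "real \<Rightarrow> real" and l :: "nat \<Rightarrow> nat \<Rightarrow> real"
  assumes cover: "\<And>n. K \<subseteq> (\<Union>i<m n. {l n i..l n i + s n})"
    and s: "\<And>n. s n > 0" "s \<longlonglongrightarrow> 0" and C: "\<And>n. real (m n) * h (s n) \<le> C"
    and h: "\<And>n. 0 \<le> h (s n)"
  shows "hausdorff_measure h K < \<infinity>"
proof -
  have "hausdorff_content h \<delta> K \<le> ennreal C" if \<delta>: "\<delta> > 0" for \<delta>
  proof -
    obtain n where n: "s n < \<delta>"
      using order_tendstoD(2)[OF s(2) \<delta>] by (metis eventually_sequentially le_refl)
    define \<G> where "\<G> = (\<lambda>i. {l n i..l n i + s n}) ` {..<m n}"
    have \<G>: "\<G> \<in> interval_covers \<delta> K"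
      unfolding interval_covers_def
    proof (intro CollectI conjI ballI)
      fix G assume "G \<in> \<G>"
      then obtain i where G: "G = {l n i..l n i + s n}" by (auto simp: \<G>_def)
      then show "\<exists>a b. a < b \<and> (G = {a<..<b} \<or> G = {a..b})"
        using s(1)[of n] by (intro exI[of _ "l n i"] exI[of _ "l n i + s n"]) auto
      show "measure lborel G \<le> \<delta>" using G n s(1)[of n] by simp
    qed (use cover[of n] in \<open>auto simp: \<G>_def\<close>)
    have "(\<Sum>\<^sub>\<infinity>G\<in>\<G>. ennreal (h (measure lborel G))) = (\<Sum>G\<in>\<G>. ennreal (h (measure lborel G)))"
      by (simp add: \<G>_def)
    also have "\<dots> \<le> (\<Sum>i<m n. ennreal (h (measure lborel {l n i..l n i + s n})))"
      unfolding \<G>_def by (rule order_trans[OF sum_image_le]) (auto simp: comp_def)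
    also have "\<dots> = ennreal (real (m n) * h (s n))"
      using s(1)[of n] h[of n] by (simp add: ennreal_mult ennreal_of_nat_eq_real_of_nat)
    also have "\<dots> \<le> ennreal C" using C by (intro ennreal_leI)
    finally show ?thesis
      unfolding hausdorff_content_def by (intro INF_lower2[OF \<G>])
  qed
  then have "hausdorff_measure h K \<le> ennreal C"
    unfolding hausdorff_measure_eq_SUP by (intro SUP_least) auto
  then show ?thesis by (simp add: le_less_trans)
qed

section \<open>A set of positive length without the extension property\<close>

text \<open>The m-th forward difference of step h is at least c h^m by the mean value theorem and at
  most 2^m S by the triangle inequality. The induction passes to the first difference
  \<open>E\<close>, which replaces c by c h and S by 2 S.\<close>

lemma finite_difference_bound:
  fixes D :: "nat \<Rightarrow> real \<Rightarrow> real"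
  assumes "\<And>k x. (D k has_real_derivative D (Suc k) x) (at x)" and h: "h > 0"
    and "\<And>x. a \<le> x \<Longrightarrow> x \<le> a + real m * h \<Longrightarrow> c \<le> D m x"
    and "\<And>x. a \<le> x \<Longrightarrow> x \<le> a + real m * h \<Longrightarrow> \<bar>D 0 x\<bar> \<le> S"
  shows "c * h ^ m \<le> 2 ^ m * S"
  using assms(1,3,4)
proof (induction m arbitrary: D S c)
  case 0
  show ?case using "0.prems"(2)[of a] "0.prems"(3)[of a] by simp
next
  case (Suc m)
  define E where "E k x = D k (x + h) - D k x" for k x
  have "c * h * h ^ m \<le> 2 ^ m * (2 * S)"
  proof (rule Suc.IH[of E])
    show "(E k has_real_derivative E (Suc k) x) (at x)" for k x
      unfolding E_def
      by (intro DERIV_diff Suc.prems(1) DERIV_shift[THEN iffD1, OF Suc.prems(1)])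
  next
    fix x assume x: "a \<le> x" "x \<le> a + real m * h"
    have "\<exists>z. x < z \<and> z < x + h \<and> D m (x + h) - D m x = (x + h - x) * D (Suc m) z"
      using h Suc.prems(1) by (intro MVT2) auto
    then obtain z where z: "x < z" "z < x + h" "E m x = h * D (Suc m) z" by (auto simp: E_def)
    have "c \<le> D (Suc m) z" using z x by (intro Suc.prems(2)) (auto simp: algebra_simps)
    then show "c * h \<le> E m x" using h z(3) by simp
  next
    fix x assume x: "a \<le> x" "x \<le> a + real m * h"
    have "\<bar>D 0 x\<bar> \<le> S" "\<bar>D 0 (x + h)\<bar> \<le> S"
      using x h by (intro Suc.prems(3); simp add: algebra_simps)+
    then show "\<bar>E 0 x\<bar> \<le> 2 * S" by (simp add: E_def)
  qed
  then show ?case by (simp add: algebra_simps)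
qed

text \<open>The monomial is a Taylor polynomial at a whose only nonzero coefficient is m!.\<close>

lemma higher_deriv_monomial:
  fixes a :: real
  shows "(deriv ^^ k) (\<lambda>x. (x - a) ^ m) x = (if k \<le> m then fact m / fact (m - k) * (x - a) ^ (m - k) else 0)"
    and smooth_monomial: "(\<lambda>x. (x - a) ^ m) \<in> smooth_functions"
proof -
  define c :: "nat \<Rightarrow> real" where "c i = (if i = m then fact m else 0)" for i
  have eq: "(\<lambda>x. (x - a) ^ m) = (\<lambda>x. \<Sum>i\<le>q. c i * (x - a) ^ i / fact i)" if "m \<le> q" for q
    using that by (simp add: c_def if_distrib[of "\<lambda>t. t * _"] if_distrib[of "\<lambda>t. t / _"] cong: if_cong)
  show "(\<lambda>x. (x - a) ^ m) \<in> smooth_functions"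
    by (subst eq[OF le_refl]) (rule taylor_poly_smooth)
  have "(deriv ^^ k) (\<lambda>x. (x - a) ^ m) x = (\<Sum>j\<le>max m k - k. c (k + j) * (x - a) ^ j / fact j)"
    by (subst eq[of "max m k"]) (auto intro: higher_deriv_taylor_poly)
  also have "\<dots> = (if k \<le> m then fact m / fact (m - k) * (x - a) ^ (m - k) else 0)"
  proof (cases "k \<le> m")
    case True
    have "(\<Sum>j\<le>max m k - k. c (k + j) * (x - a) ^ j / fact j)
        = (\<Sum>j\<in>{m - k}. c (k + j) * (x - a) ^ j / fact j)"
      using True by (intro sum.mono_neutral_right) (auto simp: c_def)
    then show ?thesis using True by (simp add: c_def)
  qed (simp add: c_def)
  finally show "(deriv ^^ k) (\<lambda>x. (x - a) ^ m) x = (if k \<le> m then fact m / fact (m - k) * (x - a) ^ (m - k) else 0)" .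
qed

section \<open>Geometry of the set \<open>blocks\<close>\<close>

lemma perfect_interval: "a < b \<Longrightarrow> perfect_set {a..b::real}"
  by (simp add: perfect_set_def islimpt_Icc flip: atLeastAtMost_def) (auto simp: islimpt_Icc)

text \<open>The quadratic exponent beats every fixed power of 2^n; the summand 2 keeps each block
  within a quarter of its left endpoint, so that the blocks are separated.\<close>

definition block_len :: "nat \<Rightarrow> real" where
  "block_len n = (1/2) ^ (n\<^sup>2 + 2)"

definition block :: "nat \<Rightarrow> real set" where
  "block n = {(1/2) ^ n..(1/2) ^ n + block_len n}"

definition blocks :: "real set" where
  "blocks = insert 0 (\<Union>n. block n)"

lemma block_len: "0 < block_len n" "block_len n \<le> (1/2) ^ n / 4"
proof -
  have "n \<le> n\<^sup>2" by (simp add: power2_eq_square)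
  then have "(1/2::real) ^ (n\<^sup>2 + 2) \<le> (1/2) ^ (n + 2)" by (intro power_decreasing) auto
  then show "block_len n \<le> (1/2) ^ n / 4" by (simp add: block_len_def)
qed (simp add: block_len_def)

lemma block_bounds: "x \<in> block n \<Longrightarrow> (1/2) ^ n \<le> x \<and> x \<le> 5/4 * (1/2) ^ n"
  using block_len(2)[of n] by (auto simp: block_def)

text \<open>Block n + 1 ends by 5/4 * 2^-(n+1) = 5/8 * 2^-n, and block n - 1 starts at 2 *
  2^-n.\<close>

lemma off_block:
  assumes "y \<in> blocks" "y \<notin> block n"
  shows "y \<le> 5/8 * (1/2) ^ n \<or> 2 * (1/2) ^ n \<le> y"
proof (cases "y = 0")
  case False
  then obtain m where m: "y \<in> block m" using assms by (auto simp: blocks_def)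
  then consider "m < n" | "n < m" using assms by (metis linorder_neqE_nat)
  then show ?thesis
  proof cases
    case 1
    then have "(1/2::real) ^ (n - 1) \<le> (1/2) ^ m" by (intro power_decreasing) auto
    moreover have "(1/2::real) ^ (n - 1) = 2 * (1/2) ^ n" using 1 by (cases n) auto
    ultimately show ?thesis using block_bounds[OF m] by linarith
  next
    case 2
    then have "(1/2::real) ^ m \<le> (1/2) ^ Suc n" by (intro power_decreasing) auto
    then show ?thesis using block_bounds[OF m] by simp
  qed
qed simp

lemma block_separated:
  assumes "x \<in> block n" "y \<in> blocks" "y \<notin> block n"
  shows "(1/2) ^ (n + 2) \<le> \<bar>x - y\<bar>"
  using block_bounds[OF assms(1)] off_block[OF assms(2,3)] by auto

lemma block_subset: "block n \<subseteq> blocks" by (auto simp: blocks_def)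

lemma blocks_subset: "blocks \<subseteq> {0..2}"
proof -
  have "block n \<subseteq> {0..2}" for n
  proof
    fix x assume "x \<in> block n"
    moreover have "(1/2::real) ^ n \<le> 1" by (simp add: power_le_one)
    moreover have "(0::real) \<le> (1/2) ^ n" by simp
    ultimately show "x \<in> {0..2}" using block_bounds[of x n] by auto
  qed
  then show ?thesis by (auto simp: blocks_def)
qed

lemma closed_blocks: "closed blocks"
proof -
  \<comment> \<open>The interval [0, 2 * 2^-N] swallows all blocks from index N on, leaving a finite
    union of closed sets; these intervals shrink to the point 0.\<close>
  have "blocks = (\<Inter>N. {0..2 * (1/2) ^ N} \<union> (\<Union>n<N. block n))" (is "_ = ?R")
  proof
    show "blocks \<subseteq> ?R"
    proof (intro INT_greatest subsetI)
      fix x N assume x: "x \<in> blocks"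
      show "x \<in> {0..2 * (1/2) ^ N} \<union> (\<Union>n<N. block n)"
      proof (cases "x = 0")
        case False
        then obtain n where n: "x \<in> block n" using x by (auto simp: blocks_def)
        show ?thesis
        proof (cases "n < N")
          case False
          then have "(1/2::real) ^ n \<le> (1/2) ^ N" by (intro power_decreasing) auto
          moreover have "(0::real) \<le> (1/2) ^ n" by simp
          ultimately have "0 \<le> x \<and> x \<le> 2 * (1/2) ^ N" using block_bounds[OF n] by linarith
          then have "x \<in> {0..2 * (1/2) ^ N}" by simp
          then show ?thesis by blast
        qed (use n in auto)
      qed simp
    qed
    show "?R \<subseteq> blocks"
    proof
      fix x assume x: "x \<in> ?R"
      show "x \<in> blocks"
      proof (rule ccontr)
        assume nx: "x \<notin> blocks"
        then have x': "0 \<le> x" "x \<le> 2 * (1/2) ^ N" for N using x by (auto simp: blocks_def)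
        have "(\<lambda>N. 2 * (1/2::real) ^ N) \<longlonglongrightarrow> 2 * 0"
          by (intro tendsto_mult tendsto_const LIMSEQ_power_zero) auto
        then have "x \<le> 2 * 0" by (rule LIMSEQ_le_const) (use x'(2) in blast)
        then have "x \<le> 0" by simp
        then show False using nx x'(1) by (auto simp: blocks_def)
      qed
    qed
  qed
  moreover have "closed ?R"
    by (intro closed_INT ballI closed_Un closed_UN) (auto simp: block_def)
  ultimately show ?thesis by simp
qed

lemma perfect_compact_blocks: "perfect_compact blocks"
proof
  show "compact blocks"
    using closed_blocks blocks_subset by (meson bounded_closed_interval bounded_subset compact_eq_bounded_closed)
  show "blocks \<noteq> {}" by (auto simp: blocks_def)
  show "perfect_set blocks"
  proof (rule perfect_setI[OF closed_blocks])
    fix x assume x: "x \<in> blocks"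
    show "x islimpt blocks"
    proof (cases "x = 0")
      case True
      have "(1/2) ^ n \<in> blocks - {0}" for n
        using block_subset[of n] block_len(1)[of n] by (auto simp: block_def)
      moreover have "(\<lambda>n. (1/2::real) ^ n) \<longlonglongrightarrow> 0" by (intro LIMSEQ_power_zero) auto
      ultimately show ?thesis unfolding islimpt_sequential True by blast
    next
      case False
      then obtain n where n: "x \<in> block n" using x by (auto simp: blocks_def)
      have "perfect_set (block n)" unfolding block_def using block_len(1) by (intro perfect_interval) simp
      then have "x islimpt block n" using n by (auto simp: perfect_set_def)
      then show ?thesis using block_subset by (rule islimpt_subset)
    qed
  qed
qed

section \<open>Test functions supported on a single block\<close>

interpretation blocks: perfect_compact blocks by (rule perfect_compact_blocks)

text \<open>Inside the block the interval estimate applies, which takes one derivative more. Between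
  the block and the rest the distance is at least 2^-(n+2), so dividing by its powers costs at most
  2^((n+2) r). The Taylor sum contributes at most r + 1 terms, the supremum norm one more.\<close>

lemma block_function_norm:
  assumes F: "F \<in> smooth_functions" and M: "0 \<le> M"
    and on: "\<And>x k. x \<in> block n \<Longrightarrow> k \<le> Suc r \<Longrightarrow> \<bar>(deriv ^^ k) F x\<bar> \<le> M"
    and off: "\<And>x k. x \<in> blocks \<Longrightarrow> x \<notin> block n \<Longrightarrow> (deriv ^^ k) F x = 0"
  shows "whitney_norm blocks r (trace_on blocks F) \<le> (real r + 2) * M * 2 ^ ((n + 2) * r)"
proof -
  let ?e = "(1/2::real) ^ (n + 2)"
  have pow: "d ^ j \<le> 2 ^ ((n + 2) * r) * d ^ i" if "?e \<le> d" "j \<le> i" "i \<le> r" for d i j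
  proof -
    have "?e ^ r \<le> ?e ^ (i - j)" using that by (intro power_decreasing power_le_one) auto
    also have "\<dots> \<le> d ^ (i - j)" using that by (intro power_mono) auto
    finally have "?e ^ r * d ^ j \<le> d ^ (i - j) * d ^ j"
      using that order_trans[of 0 ?e d] by (intro mult_right_mono) auto
    then have "?e ^ r * d ^ j \<le> d ^ i" using that by (simp flip: power_add)
    moreover have "?e ^ r = 1 / 2 ^ ((n + 2) * r)"
      by (simp only: power_mult[symmetric] power_divide power_one)
    ultimately show ?thesis by (simp add: divide_le_eq mult.commute)
  qed
  have one: "(1::real) \<le> 2 ^ ((n + 2) * r)" by (rule one_le_power) simp
  have "whitney_norm blocks r (trace_on blocks F) \<le> M + (real r + 1) * M * 2 ^ ((n + 2) * r)"
  proof (rule blocks.whitney_norm_le[OF F])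
    fix k x assume "k \<le> r" "x \<in> blocks"
    then show "\<bar>(deriv ^^ k) F x\<bar> \<le> M" using on off M by (cases "x \<in> block n") auto
  next
    fix k x y assume k: "k \<le> r" and xy: "x \<in> blocks" "y \<in> blocks" "x \<noteq> y"
    have B: "M * 2 ^ ((n + 2) * r) \<le> (real r + 1) * M * 2 ^ ((n + 2) * r)"
      using M by (simp add: distrib_right)
    consider "x \<in> block n" "y \<in> block n" | "x \<in> block n" "y \<notin> block n"
      | "x \<notin> block n" "y \<in> block n" | "x \<notin> block n" "y \<notin> block n" by blast
    then show "\<bar>jet_rem F r k y x\<bar> \<le> (real r + 1) * M * 2 ^ ((n + 2) * r) * \<bar>x - y\<bar> ^ (r - k)"
    proof cases
      case 1
      have "\<bar>jet_rem F r k y x\<bar> \<le> M * (((1/2) ^ n + block_len n) - (1/2) ^ n) * \<bar>x - y\<bar> ^ (r - k)"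
        using 1 on xy by (intro jet_rem_le F k) (auto simp: block_def simp del: funpow.simps)
      also have "\<dots> \<le> M * 2 ^ ((n + 2) * r) * \<bar>x - y\<bar> ^ (r - k)"
      proof (intro mult_right_mono mult_left_mono M)
        have "block_len n \<le> 1" using block_len(2)[of n] power_le_one[of "1/2::real" n] by simp
        then show "(1/2) ^ n + block_len n - (1/2) ^ n \<le> 2 ^ ((n + 2) * r)" using one by linarith
      qed simp
      finally show ?thesis using mult_right_mono[OF B, of "\<bar>x - y\<bar> ^ (r - k)"] by simp
    next
      case 2
      have "\<bar>jet_rem F r k y x\<bar> = \<bar>(deriv ^^ k) F x\<bar> * \<bar>x - y\<bar> ^ 0"
        using off 2 xy by (simp add: jet_rem_def)
      also have "\<dots> \<le> M * (2 ^ ((n + 2) * r) * \<bar>x - y\<bar> ^ (r - k))"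
        using on[of x k] 2 k M by (intro mult_mono pow block_separated xy) auto
      finally show ?thesis using mult_right_mono[OF B, of "\<bar>x - y\<bar> ^ (r - k)"] by simp
    next
      case 3
      have sep: "?e \<le> \<bar>x - y\<bar>" using block_separated[OF 3(2) xy(1) 3(1)] by (simp add: abs_minus_commute)
      \<comment> \<open>F vanishes to all orders at x, so the remainder is minus the whole Taylor
        polynomial from the block; \<open>pow\<close> raises each power of the distance to r -
        k.\<close>
      have "\<bar>jet_rem F r k y x\<bar> = \<bar>\<Sum>j\<le>r - k. (deriv ^^ (k + j)) F y * (x - y) ^ j / fact j\<bar>"
        using off 3 xy by (simp add: jet_rem_def)
      also have "\<dots> \<le> (\<Sum>j\<le>r - k. M * (2 ^ ((n + 2) * r) * \<bar>x - y\<bar> ^ (r - k)))"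
      proof (rule order_trans[OF sum_abs sum_mono])
        fix j assume j: "j \<in> {..r - k}"
        have "\<bar>(deriv ^^ (k + j)) F y * (x - y) ^ j / fact j\<bar> \<le> \<bar>(deriv ^^ (k + j)) F y * (x - y) ^ j\<bar> / 1"
          unfolding abs_divide by (intro frac_le) (auto simp: fact_ge_1)
        also have "\<dots> = \<bar>(deriv ^^ (k + j)) F y\<bar> * \<bar>x - y\<bar> ^ j" by (simp add: abs_mult power_abs)
        also have "\<dots> \<le> M * (2 ^ ((n + 2) * r) * \<bar>x - y\<bar> ^ (r - k))"
          using on[OF 3(2), of "k + j"] j k M by (intro mult_mono pow sep) auto
        finally show "\<bar>(deriv ^^ (k + j)) F y * (x - y) ^ j / fact j\<bar>
            \<le> M * (2 ^ ((n + 2) * r) * \<bar>x - y\<bar> ^ (r - k))" .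
      qed
      also have "\<dots> = (real (r - k) + 1) * (M * (2 ^ ((n + 2) * r) * \<bar>x - y\<bar> ^ (r - k)))" by simp
      also have "\<dots> \<le> (real r + 1) * (M * (2 ^ ((n + 2) * r) * \<bar>x - y\<bar> ^ (r - k)))"
        using M k by (intro mult_right_mono) auto
      finally show ?thesis by (simp add: mult.assoc)
    next
      case 4
      then have "jet_rem F r k y x = 0" using off xy by (simp add: jet_rem_def)
      then show ?thesis using M by simp
    qed
  qed
  also have "\<dots> \<le> M * 2 ^ ((n + 2) * r) + (real r + 1) * M * 2 ^ ((n + 2) * r)"
    using one M mult_left_mono[OF one M] by simp
  finally show ?thesis by (simp add: algebra_simps)
qed

text \<open>On \<open>blocks\<close> this is a monomial on one block and zero elsewhere.\<close>

definition block_monomial :: "nat \<Rightarrow> nat \<Rightarrow> real \<Rightarrow> real" where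
  "block_monomial n m x = cutoff (1 / block_len n * (x - (1/2) ^ n)) * (x - (1/2) ^ n) ^ m"

lemma block_monomial_smooth: "block_monomial n m \<in> smooth_functions"
  unfolding block_monomial_def[abs_def]
  by (intro smooth_mult smooth_compose[OF cutoff_smooth] smooth_monomial smooth_diff smooth_const smooth_ident)

lemma block_monomial_deriv_on:
  assumes "x \<in> block n"
  shows "(deriv ^^ k) (block_monomial n m) x
    = (if k \<le> m then fact m / fact (m - k) * (x - (1/2) ^ n) ^ (m - k) else 0)"
  unfolding higher_deriv_monomial(1)[symmetric]
proof (rule smooth_eq_on_perfect[of "block n"])
  show "perfect_set (block n)"
    unfolding block_def using block_len(1) by (intro perfect_interval) simp
  fix z assume "z \<in> block n"
  then show "block_monomial n m z = (z - (1/2) ^ n) ^ m"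
    using block_len(1)[of n] by (simp add: block_monomial_def block_def cutoff_eq_1)
qed (use assms block_monomial_smooth smooth_monomial in auto)

text \<open>The cutoff reaches one block length, at most 2^-n / 4, beyond each end of the block, and
  so dies out inside the gaps.\<close>

lemma block_monomial_deriv_off:
  assumes "x \<in> blocks" "x \<notin> block n"
  shows "(deriv ^^ k) (block_monomial n m) x = 0"
proof -
  let ?U = "- {(1/2) ^ n - block_len n..(1/2) ^ n + 2 * block_len n}"
  have "(deriv ^^ k) (block_monomial n m) x = (deriv ^^ k) (\<lambda>x. 0 * x) x"
  proof (rule higher_deriv_eq_on_open[of ?U])
    show "open ?U" by (simp add: open_Compl)
    fix z assume "z \<in> ?U"
    then have "z - (1/2) ^ n \<le> - block_len n \<or> z - (1/2) ^ n \<ge> 2 * block_len n" by auto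
    then have "1 / block_len n * (z - (1/2) ^ n) \<le> -1 \<or> 1 / block_len n * (z - (1/2) ^ n) \<ge> 2"
      using block_len(1)[of n] by (simp add: divide_le_eq le_divide_eq)
    then show "block_monomial n m z = 0 * z" by (simp add: block_monomial_def cutoff_eq_0)
  next
    have "(0::real) < (1/2) ^ n" by simp
    then have "x < (1/2) ^ n - block_len n \<or> (1/2) ^ n + 2 * block_len n < x"
      using off_block[OF assms] block_len(2)[of n] by linarith
    then show "x \<in> ?U" by auto
  qed
  also have "\<dots> = 0" using higher_deriv_cmult[OF smooth_ident, of k 0 x] by simp
  finally show ?thesis .
qed

lemma block_monomial_norm:
  assumes s: "0 \<le> s" and M: "\<And>x k. x \<in> block n \<Longrightarrow> k \<le> Suc r \<Longrightarrow> \<bar>(deriv ^^ k) (block_monomial n m) x\<bar> \<le> M"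
    and rQ: "r \<le> Q"
  shows "whitney_norm blocks r (\<lambda>x. s * trace_on blocks (block_monomial n m) x)
    \<le> s * ((real Q + 2) * M * 2 ^ ((n + 2) * Q))"
proof -
  have M0: "0 \<le> M" using M[of "(1/2) ^ n" 0] block_len(1)[of n] by (simp add: block_def)
  have eq: "(\<lambda>x. s * trace_on blocks (block_monomial n m) x) = trace_on blocks (\<lambda>x. s * block_monomial n m x)"
    by (auto simp: trace_on_def)
  note D = higher_deriv_cmult[OF block_monomial_smooth]
  have "whitney_norm blocks r (\<lambda>x. s * trace_on blocks (block_monomial n m) x)
      \<le> (real r + 2) * (s * M) * 2 ^ ((n + 2) * r)"
    unfolding eq
  proof (rule block_function_norm)
    show "(\<lambda>x. s * block_monomial n m x) \<in> smooth_functions"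
      using block_monomial_smooth by (intro smooth_mult) auto
    show "\<bar>(deriv ^^ k) (\<lambda>x. s * block_monomial n m x) x\<bar> \<le> s * M"
      if "x \<in> block n" "k \<le> Suc r" for x k
      using M[OF that] s by (simp add: D abs_mult mult_left_mono)
  qed (use s M0 block_monomial_deriv_off in \<open>auto simp: D\<close>)
  also have "\<dots> \<le> (real Q + 2) * (s * M) * 2 ^ ((n + 2) * Q)"
    using rQ s M0 by (intro mult_mono power_increasing) auto
  finally show ?thesis by (simp add: algebra_simps)
qed

section \<open>No continuous extension operator for \<open>blocks\<close>\<close>

lemma (in perfect_compact) extension_operator_bound:
  assumes W: "W \<in> whitney_functions K \<rightarrow> smooth_functions"
    "linear_on_functions (whitney_functions K) W"
    "continuous_map (whitney_topology K) smooth_topology W"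
  shows "\<exists>Q. \<exists>e>0. \<forall>g\<in>whitney_functions K. (\<forall>q\<le>Q. whitney_norm K q g < e) \<longrightarrow> smooth_seminorm p (W g) < 1"
proof -
  let ?V = "whitney_functions K"
  let ?U = "{g \<in> smooth_functions. smooth_seminorm p (\<lambda>x. g x - 0) < 1}"
  have "(\<lambda>x. 0) = trace_on K (\<lambda>x. 0)" by (auto simp: trace_on_def)
  then have V0: "(\<lambda>x. 0) \<in> ?V" using trace_on_whitney[OF smooth_const] by metis
  have "\<And>c f. f \<in> ?V \<Longrightarrow> W (\<lambda>x. c * f x) = (\<lambda>x. c * W f x)"
    using W(2) by (auto simp: linear_on_functions_def)
  from this[OF V0, of 0] have W0: "W (\<lambda>x. 0) = (\<lambda>x. 0)" by simp
  have top: "topspace (whitney_topology K) = ?V"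
    unfolding whitney_topology_def by (rule topspace_seminorm_topology) (rule whitney_norm_0)
  have "openin smooth_topology ?U"
    unfolding smooth_topology_def seminorm_topology_def
    by (rule topology_generated_by_Basis, rule CollectI,
        rule exI[of _ p], rule exI[of _ "\<lambda>x. 0"], rule exI[of _ 1]) simp
  then have "openin (whitney_topology K) {g \<in> ?V. W g \<in> ?U}"
    using openin_continuous_map_preimage[OF W(3), of ?U] by (simp only: top)
  moreover have "(\<lambda>x. 0) \<in> {g \<in> ?V. W g \<in> ?U}" using V0 W0 by (simp add: smooth_seminorm_0)
  ultimately obtain Q e where "e > 0"
    "\<forall>g\<in>?V. (\<forall>q\<le>Q. whitney_norm K q (\<lambda>x. g x - 0) < e) \<longrightarrow> g \<in> {g \<in> ?V. W g \<in> ?U}"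
    using seminorm_topology_nbhd[of ?V "whitney_norm K", OF whitney_norm_add whitney_functions_diff]
    unfolding whitney_topology_def using V0 by blast
  then show ?thesis by (auto intro!: exI[of _ Q] exI[of _ e])
qed

text \<open>With C < 2^j it is enough that (n + 2) R + j \<le> n^2. The left side is at most 3 n R +
  n (1 + j), which is n^2 for n = 3 R + 1 + j.\<close>

lemma block_len_decay: "\<exists>n. C * block_len n * 2 ^ ((n + 2) * R) < (1::real)"
proof -
  obtain j where j: "C < 2 ^ j" using real_arch_pow[of 2 C] by auto
  define n where "n = 3 * R + 1 + j"
  have "(n + 2) * R + j \<le> 3 * n * R + n * (1 + j)"
    by (intro add_mono mult_right_mono) (auto simp: n_def)
  also have "\<dots> = n\<^sup>2" by (simp add: n_def power2_eq_square algebra_simps)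
  finally have "(2::real) ^ ((n + 2) * R + j) \<le> 2 ^ (n\<^sup>2 + 2)" by (intro power_increasing) auto
  then have "2 ^ ((n + 2) * R) * 2 ^ j * block_len n \<le> 1"
    by (simp add: block_len_def power_add power_one_over field_simps)
  moreover have "C * block_len n * 2 ^ ((n + 2) * R) < 2 ^ j * block_len n * 2 ^ ((n + 2) * R)"
    using j block_len(1)[of n] by (intro mult_strict_right_mono) auto
  ultimately show ?thesis by (intro exI[of _ n]) (simp add: mult_ac)
qed

text \<open>The difference estimate would force \<open>block_len n\<close> to be at least a constant
  times 2^-((n+2) (Q + Q' m)) for every n, which \<open>block_len_decay\<close> contradicts.\<close>

theorem blocks_no_extension: "\<not> extension_property blocks"
proof
  assume "extension_property blocks"
  then obtain W where W: "W \<in> whitney_functions blocks \<rightarrow> smooth_functions"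
    and lin: "linear_on_functions (whitney_functions blocks) W"
    and cont: "continuous_map (whitney_topology blocks) smooth_topology W"
    and ext: "\<And>f. f \<in> whitney_functions blocks \<Longrightarrow> trace_on blocks (W f) = f"
    unfolding extension_property_def by blast
  obtain Q e where e: "e > 0"
    and Q: "\<And>g. g \<in> whitney_functions blocks \<Longrightarrow> (\<And>q. q \<le> Q \<Longrightarrow> whitney_norm blocks q g < e)
      \<Longrightarrow> smooth_seminorm 2 (W g) < 1"
    using blocks.extension_operator_bound[OF W lin cont, of 2] by blast
  \<comment> \<open>Derivatives of (x - a)^m of order up to Q + 1 then keep a factor x - a, hence
    are at most m! times the block length on the block.\<close>
  define m where "m = Q + 2"
  obtain Q' e' where e': "e' > 0"
    and Q': "\<And>g. g \<in> whitney_functions blocks \<Longrightarrow> (\<And>q. q \<le> Q' \<Longrightarrow> whitney_norm blocks q g < e')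
      \<Longrightarrow> smooth_seminorm (m + 2) (W g) < 1"
    using blocks.extension_operator_bound[OF W lin cont, of "m + 2"] by blast
  \<comment> \<open>Linearity turns the neighbourhood of zero into a quantitative bound: the test
    function is scaled to norms of at most d/2.\<close>
  have scaled: "\<bar>(deriv ^^ k) (W (trace_on blocks (block_monomial n m))) x\<bar> \<le> 2 / d * ((real R + 2) * M * 2 ^ ((n + 2) * R))"
    if d: "d > 0" and M: "M > 0" "\<And>x k. x \<in> block n \<Longrightarrow> k \<le> Suc R \<Longrightarrow> \<bar>(deriv ^^ k) (block_monomial n m) x\<bar> \<le> M"
      and small: "\<And>g. g \<in> whitney_functions blocks \<Longrightarrow> (\<And>q. q \<le> R \<Longrightarrow> whitney_norm blocks q g < d)
        \<Longrightarrow> smooth_seminorm p (W g) < 1"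
      and kx: "k \<le> p" "\<bar>x\<bar> \<le> real p" for d M n R p k x
  proof -
    let ?f = "trace_on blocks (block_monomial n m)"
    define N where "N = (real R + 2) * M * 2 ^ ((n + 2) * R)"
    have N: "N > 0" unfolding N_def using M by (intro mult_pos_pos) auto
    define s where "s = d / (2 * N)"
    have s: "s > 0" using d N by (simp add: s_def)
    have f: "?f \<in> whitney_functions blocks" by (intro blocks.trace_on_whitney block_monomial_smooth)
    have sf: "(\<lambda>x. s * ?f x) \<in> whitney_functions blocks" by (intro blocks.whitney_functions_cmult f)
    have "smooth_seminorm p (W (\<lambda>x. s * ?f x)) < 1"
    proof (rule small[OF sf])
      fix q assume "q \<le> R"
      then have "whitney_norm blocks q (\<lambda>x. s * ?f x) \<le> s * N"
        unfolding N_def using s M by (intro block_monomial_norm) auto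
      also have "\<dots> < d" using d N by (simp add: s_def)
      finally show "whitney_norm blocks q (\<lambda>x. s * ?f x) < d" .
    qed
    moreover have "W (\<lambda>x. s * ?f x) = (\<lambda>x. s * W ?f x)"
      using lin f unfolding linear_on_functions_def by blast
    moreover have Wf: "W ?f \<in> smooth_functions" using W f by auto
    then have "\<bar>(deriv ^^ k) (\<lambda>x. s * W ?f x) x\<bar> \<le> smooth_seminorm p (\<lambda>x. s * W ?f x)"
      using kx by (intro smooth_seminorm_upper) auto
    ultimately have "s * \<bar>(deriv ^^ k) (W ?f) x\<bar> \<le> 1"
      using s by (simp add: higher_deriv_cmult[OF Wf] abs_mult)
    then show ?thesis unfolding N_def[symmetric] using d N by (simp add: s_def field_simps)
  qed
  define C1 where "C1 = 2 / e * ((real Q + 2) * fact m)"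
  \<comment> \<open>The maximum with 1 gives M \<ge> 1 below and thus a difference window of length
    at most 1/2, which stays in [-2, 2].\<close>
  define C2 where "C2 = max 1 (2 / e' * ((real Q' + 2) * fact m))"
  define C where "C = 2 * 2 ^ m * C1 * (2 * real m * C2) ^ m"
  obtain n where n: "C * block_len n * 2 ^ ((n + 2) * (Q + Q' * m)) < 1"
    using block_len_decay by blast
  let ?a = "(1/2::real) ^ n"
  define G where "G = W (trace_on blocks (block_monomial n m))"
  have fV: "trace_on blocks (block_monomial n m) \<in> whitney_functions blocks"
    by (intro blocks.trace_on_whitney block_monomial_smooth)
  have G: "G \<in> smooth_functions" unfolding G_def using W fV by auto
  have l1: "block_len n \<le> 1" using block_len(2)[of n] power_le_one[of "1/2::real" n] by simp
  have dist: "0 \<le> x - ?a" "x - ?a \<le> block_len n" if "x \<in> block n" for x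
    using that by (auto simp: block_def)
  have mono_le: "\<bar>fact m / fact (m - k) * (x - ?a) ^ (m - k)\<bar> \<le> fact m * (x - ?a) ^ (m - k)"
    if "x \<in> block n" for x k
  proof -
    have "fact m / fact (m - k) \<le> (fact m / 1 :: real)" by (intro frac_le) (auto simp: fact_ge_1)
    then have "fact m / fact (m - k) * (x - ?a) ^ (m - k) \<le> fact m * (x - ?a) ^ (m - k)"
      using dist[OF that] by (intro mult_right_mono) auto
    then show ?thesis using dist[OF that] by (simp add: abs_mult)
  qed
  have G0: "\<bar>(deriv ^^ 0) G x\<bar> \<le> C1 * block_len n * 2 ^ ((n + 2) * Q)" if x: "\<bar>x\<bar> \<le> 2" for x
  proof -
    have "\<bar>(deriv ^^ 0) G x\<bar> \<le> 2 / e * ((real Q + 2) * (fact m * block_len n) * 2 ^ ((n + 2) * Q))"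
      unfolding G_def
    proof (rule scaled[OF e])
      fix x k assume x: "x \<in> block n" and k: "k \<le> Suc Q"
      have "(x - ?a) ^ (m - k) \<le> (x - ?a) ^ 1"
        using dist[OF x] l1 k by (intro power_decreasing) (auto simp: m_def)
      then have "(x - ?a) ^ (m - k) \<le> block_len n" using dist[OF x] by simp
      then have "fact m * (x - ?a) ^ (m - k) \<le> fact m * block_len n" by simp
      then show "\<bar>(deriv ^^ k) (block_monomial n m) x\<bar> \<le> fact m * block_len n"
        unfolding block_monomial_deriv_on[OF x] using order_trans[OF mono_le[OF x, of k]] k
        by (simp add: m_def del: fact_Suc add_2_eq_Suc')
    qed (use Q x block_len(1) in auto)
    then show ?thesis by (simp only: C1_def mult_ac)
  qed
  define M where "M = C2 * 2 ^ ((n + 2) * Q')"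
  have M1: "1 \<le> M" unfolding M_def C2_def using mult_mono[of 1 _ 1] one_le_power[of "2::real"] by (smt (verit) max.cobounded1)
  have Gm: "\<bar>(deriv ^^ Suc m) G x\<bar> \<le> M" if x: "\<bar>x\<bar> \<le> real (m + 2)" for x
  proof -
    have "\<bar>(deriv ^^ Suc m) G x\<bar> \<le> 2 / e' * ((real Q' + 2) * fact m * 2 ^ ((n + 2) * Q'))"
      unfolding G_def
    proof (rule scaled[OF e'])
      fix x k assume x: "x \<in> block n"
      have "(x - ?a) ^ (m - k) \<le> 1" using dist[OF x] l1 by (intro power_le_one) auto
      then have "fact m * (x - ?a) ^ (m - k) \<le> fact m * 1" by (intro mult_left_mono) auto
      then show "\<bar>(deriv ^^ k) (block_monomial n m) x\<bar> \<le> fact m"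
        unfolding block_monomial_deriv_on[OF x] using order_trans[OF mono_le[OF x, of k]] by simp
    qed (use Q' x in auto)
    also have "\<dots> = 2 / e' * ((real Q' + 2) * fact m) * 2 ^ ((n + 2) * Q')" by simp
    also have "\<dots> \<le> M" unfolding M_def C2_def by (intro mult_right_mono) auto
    finally show ?thesis .
  qed
  have a_block: "?a \<in> block n" using block_len(1)[of n] by (simp add: block_def)
  \<comment> \<open>Extension and test function agree on a perfect set, hence so do all their
    derivatives there.\<close>
  have "(deriv ^^ m) G ?a = (deriv ^^ m) (block_monomial n m) ?a"
  proof (rule smooth_eq_on_perfect[OF blocks.perf G block_monomial_smooth])
    fix z assume "z \<in> blocks"
    then show "G z = block_monomial n m z"
      using ext[OF fV] by (auto simp: G_def trace_on_def fun_eq_iff) metis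
  qed (use a_block block_subset in auto)
  also have "\<dots> = fact m" using block_monomial_deriv_on[OF a_block, of m m] by simp
  finally have Ga: "(deriv ^^ m) G ?a \<ge> 1" using fact_ge_1[of m] by simp
  \<comment> \<open>Over a window of length m h the m-th derivative moves by at most m h M = 1/2
    from a value of at least 1.\<close>
  define h where "h = 1 / (2 * real m * M)"
  have m0: "m > 0" by (simp add: m_def)
  have h: "h > 0" "real m * h * M = 1/2" using M1 m0 by (auto simp: h_def)
  have mh: "real m * h \<le> 1/2"
    using h M1 m0 by (simp add: h_def field_simps)
  have a1: "?a \<le> 1" "?a > 0" by (auto simp: power_le_one)
  have "1/2 * h ^ m \<le> 2 ^ m * (C1 * block_len n * 2 ^ ((n + 2) * Q))"
  proof (rule finite_difference_bound[of "\<lambda>k. (deriv ^^ k) G", OF smooth_has_derivs[OF G] h(1)])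
    fix x assume x: "?a \<le> x" "x \<le> ?a + real m * h"
    show "\<bar>(deriv ^^ 0) G x\<bar> \<le> C1 * block_len n * 2 ^ ((n + 2) * Q)"
      using x a1 mh by (intro G0) linarith
    show "1/2 \<le> (deriv ^^ m) G x"
    proof (cases "x = ?a")
      case False
      then obtain z where z: "?a < z" "z < x" "(deriv ^^ m) G x - (deriv ^^ m) G ?a = (x - ?a) * (deriv ^^ Suc m) G z"
        using MVT2[of ?a x "(deriv ^^ m) G" "(deriv ^^ Suc m) G"] smooth_has_derivs[OF G, of m] x by auto
      have "\<bar>(x - ?a) * (deriv ^^ Suc m) G z\<bar> \<le> (real m * h) * M"
        unfolding abs_mult
      proof (intro mult_mono Gm)
        show "\<bar>x - ?a\<bar> \<le> real m * h" "\<bar>z\<bar> \<le> real (m + 2)" using x z a1 mh by linarith+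
      qed (use h in auto)
      then show ?thesis using z(3) h(2) Ga by linarith
    qed (use Ga in simp)
  qed
  moreover have "h ^ m * ((2 * real m * C2) ^ m * 2 ^ ((n + 2) * (Q' * m))) = 1"
  proof -
    have "h * (2 * real m * C2 * 2 ^ ((n + 2) * Q')) = 1"
      using m0 M1 by (auto simp: h_def M_def)
    then have "(h * (2 * real m * C2 * 2 ^ ((n + 2) * Q'))) ^ m = 1" by simp
    then show ?thesis
      by (simp only: power_mult_distrib power_mult[symmetric] mult.assoc)
  qed
  moreover have "0 \<le> (2 * real m * C2) ^ m * 2 ^ ((n + 2) * (Q' * m))" by (simp add: C2_def)
  ultimately have "1/2 * 1 \<le> 2 ^ m * (C1 * block_len n * 2 ^ ((n + 2) * Q)) * ((2 * real m * C2) ^ m * 2 ^ ((n + 2) * (Q' * m)))"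
    by (metis mult.assoc mult_right_mono)
  also have "\<dots> = 1/2 * (C * block_len n * 2 ^ ((n + 2) * (Q + Q' * m)))"
    unfolding distrib_left[of _ Q] power_add C_def by simp
  finally show False using n by simp
qed

section \<open>Linear measure of \<open>blocks\<close>\<close>

lemma h_set_blocks: "h_set (\<lambda>t. t) blocks"
  unfolding h_set_def
proof
  show "0 < hausdorff_measure (\<lambda>t. t) blocks"
  proof (rule hausdorff_measure_pos[where x="\<lambda>t. t" and b="\<lambda>t. t" and S="block 0" and C=1])
    show "{1..<1 + block_len 0} \<subseteq> (\<lambda>t. t) ` block 0" by (auto simp: block_def)
    show "1 < 1 + block_len 0" using block_len(1)[of 0] by simp
  qed (use block_subset in auto)
  show "hausdorff_measure (\<lambda>t. t) blocks < \<infinity>"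
  proof (rule hausdorff_measure_finite[where K=blocks and h="\<lambda>t. t" and s="\<lambda>n. inverse (real (Suc n))" and m="\<lambda>n. 2 * Suc n"
        and l="\<lambda>n i. real i / real (Suc n)" and C=2])
    show "(\<lambda>n. inverse (real (Suc n))) \<longlonglongrightarrow> 0" by (rule LIMSEQ_inverse_real_of_nat)
    fix n
    show "blocks \<subseteq> (\<Union>i<2 * Suc n. {real i / real (Suc n)..real i / real (Suc n) + inverse (real (Suc n))})"
    proof
      fix x assume "x \<in> blocks"
      then have x: "0 \<le> x" "x \<le> 2" using blocks_subset by auto
      \<comment> \<open>The minimum catches x = 2, whose floor is one index too high.\<close>
      define i where "i = min (nat \<lfloor>x * real (Suc n)\<rfloor>) (2 * n + 1)"
      have "real i \<le> x * real (Suc n)" using x by (simp add: i_def min_def; linarith)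
      moreover have "x * real (Suc n) \<le> real i + 1"
      proof (cases "nat \<lfloor>x * real (Suc n)\<rfloor> \<le> 2 * n + 1")
        case True
        then show ?thesis using x by (simp add: i_def; linarith)
      next
        case False
        have "x * real (Suc n) \<le> 2 * real (Suc n)" using x by (intro mult_right_mono) auto
        then show ?thesis using False by (simp add: i_def)
      qed
      ultimately have "x \<in> {real i / real (Suc n)..real i / real (Suc n) + inverse (real (Suc n))}"
        by (simp add: divide_le_eq inverse_eq_divide add_divide_distrib[symmetric] le_divide_eq)
      moreover have "i < 2 * Suc n" by (simp add: i_def)
      ultimately show "x \<in> (\<Union>i<2 * Suc n. {real i / real (Suc n)..real i / real (Suc n) + inverse (real (Suc n))})"
        by blast
    qed
    show "real (2 * Suc n) * inverse (real (Suc n)) \<le> 2" by (simp add: field_simps)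
  qed auto
qed

section \<open>The Cantor set of ratio one quarter\<close>

text \<open>The binary digits of i, the last one being the finest, become the base 4 digits 0 and 3;
  the parent of cell i is cell \<open>i div 2\<close>.\<close>

primrec cantor_left :: "nat \<Rightarrow> nat \<Rightarrow> real" where
  "cantor_left 0 i = 0"
| "cantor_left (Suc n) i = cantor_left n (i div 2) + 3 * real (i mod 2) / 4 ^ Suc n"

definition cylinder :: "nat \<Rightarrow> nat \<Rightarrow> real set" where
  "cylinder n i = {cantor_left n i..cantor_left n i + 1 / 4 ^ n}"

definition cantor :: "real set" where
  "cantor = (\<Inter>n. \<Union>i<2 ^ n. cylinder n i)"

text \<open>Siblings are three cell lengths apart. For different parents the separation is 12 child
  lengths, of which the last digits take back at most 3.\<close>

lemma cantor_left_separated: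
  "i < j \<Longrightarrow> j < 2 ^ n \<Longrightarrow> cantor_left n i + 3 / 4 ^ n \<le> cantor_left n j"
proof (induction n arbitrary: i j)
  case (Suc n)
  define d :: real where "d = 1 / 4 ^ Suc n"
  have d: "d > 0" "1 / 4 ^ n = 4 * d" by (auto simp: d_def)
  have digit: "0 \<le> 3 * real (i mod 2) / 4 ^ Suc n" "3 * real (i mod 2) / 4 ^ Suc n \<le> 3 * d"
    for i :: nat
    by (auto simp: d_def divide_simps)
  show ?case
  proof (cases "i div 2 = j div 2")
    case True
    then have "i mod 2 = 0" "j mod 2 = 1" using Suc.prems(1) by presburger+
    then show ?thesis using True by simp
  next
    case False
    then have "i div 2 < j div 2" using Suc.prems(1) by presburger
    then have "cantor_left n (i div 2) + 3 / 4 ^ n \<le> cantor_left n (j div 2)"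
      using Suc.prems(2) by (intro Suc.IH) auto
    moreover have "3 / 4 ^ n = 12 * d" "3 / 4 ^ Suc n = 3 * d" by (auto simp: d_def)
    ultimately show ?thesis using digit[of i] digit[of j] d unfolding cantor_left.simps by linarith
  qed
qed simp

lemma cylinder_nested: "cylinder (Suc n) i \<subseteq> cylinder n (i div 2)"
proof -
  have "real (i mod 2) \<le> 1" by simp
  then show ?thesis by (auto simp: cylinder_def divide_simps)
qed

lemma level_antimono:
  "n \<le> m \<Longrightarrow> (\<Union>i<2 ^ m. cylinder m i) \<subseteq> (\<Union>i<2 ^ n. cylinder n i)"
proof (induction m rule: dec_induct)
  case (step m)
  have "(\<Union>i<2 ^ Suc m. cylinder (Suc m) i) \<subseteq> (\<Union>i<2 ^ m. cylinder m i)"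
  proof
    fix x assume "x \<in> (\<Union>i<2 ^ Suc m. cylinder (Suc m) i)"
    then obtain i where "i < 2 ^ Suc m" "x \<in> cylinder m (i div 2)" using cylinder_nested by blast
    moreover from this have "i div 2 < 2 ^ m" by auto
    ultimately show "x \<in> (\<Union>i<2 ^ m. cylinder m i)" by blast
  qed
  then show ?case using step.IH by blast
qed simp

lemma cantorI:
  assumes "\<And>m. m \<ge> n \<Longrightarrow> \<exists>i<2 ^ m. x \<in> cylinder m i"
  shows "x \<in> cantor"
  unfolding cantor_def
proof
  fix m
  have "x \<in> (\<Union>i<2 ^ max n m. cylinder (max n m) i)" using assms[of "max n m"] by auto
  then show "x \<in> (\<Union>i<2 ^ m. cylinder m i)" using level_antimono[of m "max n m"] by auto
qed

lemma cylinder_right_in_cantor: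
  assumes "i < 2 ^ n" shows "cantor_left n i + 1 / 4 ^ n \<in> cantor"
proof (rule cantorI[of n])
  fix m assume "n \<le> m"
  then have "\<exists>j<2 ^ m. cantor_left n i + 1 / 4 ^ n = cantor_left m j + 1 / 4 ^ m"
  proof (induction m rule: dec_induct)
    case base
    then show ?case using assms by blast
  next
    case (step m)
    then obtain j where "j < 2 ^ m" "cantor_left n i + 1 / 4 ^ n = cantor_left m j + 1 / 4 ^ m" by blast
    then show ?case by (intro exI[of _ "Suc (2 * j)"]) auto
  qed
  then show "\<exists>j<2 ^ m. cantor_left n i + 1 / 4 ^ n \<in> cylinder m j" by (auto simp: cylinder_def)
qed

lemma cantor_left_mult: "cantor_left (n + k) (i * 2 ^ k) = cantor_left n i"
proof (induction k)
  case (Suc k)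
  have "i * 2 ^ Suc k div 2 = i * 2 ^ k" by simp
  then show ?case using Suc by simp
qed simp

text \<open>The interpolation nodes are right endpoints of leftmost descendants, so f is sampled on
  the Cantor set only.\<close>

lemma cantor_node:
  assumes "i < 2 ^ n"
  shows "cantor_left n i + 1 / 4 ^ j / 4 ^ n \<in> cantor"
proof -
  have "cantor_left (n + j) (i * 2 ^ j) + 1 / 4 ^ (n + j) \<in> cantor"
    using assms by (intro cylinder_right_in_cantor) (simp add: power_add)
  then show ?thesis by (simp add: cantor_left_mult power_add mult.commute)
qed

lemma cylinder_left_in_cantor:
  assumes "i < 2 ^ n" shows "cantor_left n i \<in> cantor"
proof (rule cantorI[of n])
  fix m assume "n \<le> m"
  then obtain k where k: "m = n + k" by (metis le_Suc_ex)
  have "cantor_left n i \<in> cylinder m (i * 2 ^ k)" by (simp add: cylinder_def k cantor_left_mult)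
  moreover have "i * 2 ^ k < 2 ^ m" using assms by (simp add: k power_add)
  ultimately show "\<exists>j<2 ^ m. cantor_left n i \<in> cylinder m j" by blast
qed

lemma cantor_cylinder:
  assumes "x \<in> cantor" obtains i where "i < 2 ^ n" "x \<in> cylinder n i"
  using assms by (auto simp: cantor_def)

lemma perfect_compact_cantor: "perfect_compact cantor"
proof
  have closed: "closed cantor"
    unfolding cantor_def by (intro closed_INT ballI closed_UN) (auto simp: cylinder_def)
  have "cantor \<subseteq> {0..1}" 
  proof
    fix x assume "x \<in> cantor"
    then obtain i where "x \<in> cylinder 0 i" using cantor_cylinder by blast
    then show "x \<in> {0..1}" by (simp add: cylinder_def)
  qed
  then show "compact cantor"
    using closed by (meson bounded_closed_interval bounded_subset compact_eq_bounded_closed)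
  show "cantor \<noteq> {}" using cylinder_left_in_cantor[of 0 0] by auto
  show "perfect_set cantor"
  proof (rule perfect_setI[OF closed])
    fix x assume x: "x \<in> cantor"
    show "x islimpt cantor"
      unfolding islimpt_approachable
    proof (intro allI impI)
      fix e :: real assume e: "e > 0"
      obtain n where n: "(1/4) ^ n < e" using real_arch_pow_inv[OF e, of "1/4"] by auto
      obtain i where i: "i < 2 ^ n" "x \<in> cylinder n i" by (rule cantor_cylinder[OF x])
      define y where "y = (if x = cantor_left n i then x + 1 / 4 ^ n else cantor_left n i)"
      have "y \<in> cantor"
        using cylinder_right_in_cantor[OF i(1)] cylinder_left_in_cantor[OF i(1)] by (simp add: y_def)
      moreover have "y \<noteq> x" by (simp add: y_def)
      moreover have "dist y x < e"
        using i(2) n by (auto simp: y_def cylinder_def dist_real_def power_one_over)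
      ultimately show "\<exists>y\<in>cantor. y \<noteq> x \<and> dist y x < e" by blast
    qed
  qed
qed

interpretation cantor: perfect_compact cantor by (rule perfect_compact_cantor)

section \<open>Square root measure of the Cantor set\<close>

text \<open>The binary digits of \<open>t\<close> select a nested sequence of cylinders, whose common point is
  \<open>cantor_point t\<close>.\<close>

definition binary_prefix :: "nat \<Rightarrow> real \<Rightarrow> nat" where
  "binary_prefix n t = nat \<lfloor>2 ^ n * t\<rfloor>"

definition cantor_point :: "real \<Rightarrow> real" where
  "cantor_point t = (SUP n. cantor_left n (binary_prefix n t))"

lemma binary_prefix_less: "0 \<le> t \<Longrightarrow> t < 1 \<Longrightarrow> binary_prefix n t < 2 ^ n"
  unfolding binary_prefix_def by (subst nat_less_iff) (auto simp: floor_less_iff)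

lemma binary_prefix_Suc: "0 \<le> t \<Longrightarrow> binary_prefix (Suc n) t div 2 = binary_prefix n t"
proof -
  assume t: "0 \<le> t"
  have "\<lfloor>2 ^ Suc n * t\<rfloor> div 2 = \<lfloor>2 ^ Suc n * t / real_of_int 2\<rfloor>"
    by (rule floor_divide_real_eq_div[symmetric]) simp
  then show ?thesis
    unfolding binary_prefix_def using t nat_div_distrib[of "\<lfloor>2 ^ Suc n * t\<rfloor>" 2] by simp
qed

lemma cantor_point_cylinder:
  assumes "0 \<le> t"
  shows "cantor_point t \<in> cylinder n (binary_prefix n t)"
proof -
  let ?g = "\<lambda>n. cantor_left n (binary_prefix n t)"
  have nested: "cylinder m (binary_prefix m t) \<subseteq> cylinder n (binary_prefix n t)" if "n \<le> m" for m n
    using that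
    by (induction m rule: dec_induct) (use cylinder_nested binary_prefix_Suc[OF assms] in fastforce)+
  have g: "?g m \<le> ?g n + 1 / 4 ^ n" for m n
  proof (cases "n \<le> m")
    case True
    have "?g m \<in> cylinder m (binary_prefix m t)" by (simp add: cylinder_def)
    then have "?g m \<in> cylinder n (binary_prefix n t)" using nested[OF True] by blast
    then show ?thesis by (simp add: cylinder_def)
  next
    case False
    have "?g n \<in> cylinder n (binary_prefix n t)" by (simp add: cylinder_def)
    then have "?g n \<in> cylinder m (binary_prefix m t)" using nested[of m n] False by auto
    then have "?g m \<le> ?g n" by (simp add: cylinder_def)
    then show ?thesis by (simp add: add_increasing2)
  qed
  have "bdd_above (range ?g)" using g[of _ 0] by (intro bdd_aboveI[of _ "?g 0 + 1 / 4 ^ 0"]) auto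
  then show ?thesis
    unfolding cylinder_def cantor_point_def by (auto intro!: cSUP_upper cSUP_least g)
qed

lemma cantor_point_in_cantor: "0 \<le> t \<Longrightarrow> t < 1 \<Longrightarrow> cantor_point t \<in> cantor"
  using cantor_point_cylinder binary_prefix_less by (intro cantorI[of 0]) blast

text \<open>Let k be the first level at which the prefixes differ. Agreement one level earlier gives
  |s - t| < 2 * 2^-k, while the separation of level k cylinders puts the points at least 4^-k
  apart.\<close>

lemma cantor_point_inverse_hoelder:
  assumes st: "0 \<le> s" "s < 1" "0 \<le> t" "t < 1"
  shows "\<bar>s - t\<bar> \<le> 2 * sqrt \<bar>cantor_point s - cantor_point t\<bar>"
proof (cases "s = t")
  case False
  obtain n where n: "1 / \<bar>s - t\<bar> < 2 ^ n" using real_arch_pow[of 2] by auto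
  have "\<bar>2 ^ n * s - 2 ^ n * t\<bar> = 2 ^ n * \<bar>s - t\<bar>" by (simp add: abs_mult flip: right_diff_distrib)
  then have "1 < \<bar>2 ^ n * s - 2 ^ n * t\<bar>" using n False by (simp add: divide_less_eq)
  then have "\<lfloor>2 ^ n * s\<rfloor> \<noteq> \<lfloor>2 ^ n * t\<rfloor>" by linarith
  then have "binary_prefix n s \<noteq> binary_prefix n t"
    using st by (simp add: binary_prefix_def eq_nat_nat_iff)
  define k where "k = (LEAST n. binary_prefix n s \<noteq> binary_prefix n t)"
  have k: "binary_prefix k s \<noteq> binary_prefix k t"
    unfolding k_def by (rule LeastI) fact
  then have "k \<noteq> 0" using st binary_prefix_less[of s 0] binary_prefix_less[of t 0] by (metis less_one power_0)
  then obtain l where l: "k = Suc l" by (cases k) auto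
  have "binary_prefix l s = binary_prefix l t"
    using not_less_Least[of l "\<lambda>n. binary_prefix n s \<noteq> binary_prefix n t"] l by (auto simp: k_def)
  then have "\<lfloor>2 ^ l * s\<rfloor> = \<lfloor>2 ^ l * t\<rfloor>" using st by (simp add: binary_prefix_def eq_nat_nat_iff)
  then have "\<bar>2 ^ l * s - 2 ^ l * t\<bar> < 1" by linarith
  then have "2 ^ l * \<bar>s - t\<bar> < 1" by (simp add: abs_mult flip: right_diff_distrib)
  then have st_le: "\<bar>s - t\<bar> \<le> 2 * (1 / 2 ^ k)" by (simp add: l field_simps)
  have sep: "3 / 4 ^ k \<le> \<bar>cantor_left k (binary_prefix k s) - cantor_left k (binary_prefix k t)\<bar>"
    using k cantor_left_separated[of "binary_prefix k s" "binary_prefix k t" k]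
      cantor_left_separated[of "binary_prefix k t" "binary_prefix k s" k]
      binary_prefix_less[of s k] binary_prefix_less[of t k] st
    by (cases "binary_prefix k s < binary_prefix k t") auto
  have "1 / 4 ^ k \<le> \<bar>cantor_point s - cantor_point t\<bar>"
  proof -
    have "3 / 4 ^ k = 3 * (1 / 4 ^ k :: real)" by simp
    then show ?thesis
      using sep cantor_point_cylinder[OF st(1), of k] cantor_point_cylinder[OF st(3), of k]
      unfolding cylinder_def atLeastAtMost_iff by linarith
  qed
  then have "sqrt (1 / 4 ^ k) \<le> sqrt \<bar>cantor_point s - cantor_point t\<bar>" by simp
  moreover have "sqrt (1 / 4 ^ k) = 1 / 2 ^ k"
    by (rule real_sqrt_unique) (simp_all add: power_divide power2_eq_square flip: power_mult_distrib)
  ultimately show ?thesis using st_le by linarith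
qed simp

lemma h_set_cantor: "h_set sqrt cantor"
  unfolding h_set_def
proof
  show "0 < hausdorff_measure sqrt cantor"
    by (rule hausdorff_measure_pos[where x=cantor_point and b="\<lambda>t. t" and S="{0..<1}" and C=2 and c=0 and d=1])
      (auto intro: cantor_point_in_cantor cantor_point_inverse_hoelder)
  show "hausdorff_measure sqrt cantor < \<infinity>"
  proof (rule hausdorff_measure_finite[where s="\<lambda>n. 1 / 4 ^ n" and m="\<lambda>n. 2 ^ n" and l=cantor_left and C=1])
    show "cantor \<subseteq> (\<Union>i<2 ^ n. {cantor_left n i..cantor_left n i + 1 / 4 ^ n})" for n
      by (auto simp: cantor_def cylinder_def)
    have "(\<lambda>n. (1/4::real) ^ n) \<longlonglongrightarrow> 0" by (intro LIMSEQ_power_zero) auto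
    then show "(\<lambda>n. 1 / 4 ^ n :: real) \<longlonglongrightarrow> 0" by (simp add: power_one_over)
    have "sqrt (1 / 4 ^ n) = 1 / 2 ^ n" for n
      by (rule real_sqrt_unique) (simp_all add: power_divide power2_eq_square flip: power_mult_distrib)
    then show "real (2 ^ n) * sqrt (1 / 4 ^ n) \<le> 1" for n by simp
  qed auto
qed

section \<open>Extension by local interpolation\<close>

lemma smooth_series:
  fixes t :: "nat \<Rightarrow> real \<Rightarrow> real"
  assumes t: "\<And>n. t n \<in> smooth_functions"
    and M: "\<And>k. summable (M k)" "\<And>k n x. \<bar>(deriv ^^ k) (t n) x\<bar> \<le> M k n"
  shows "(\<lambda>x. \<Sum>n. t n x) \<in> smooth_functions"
    and "(deriv ^^ k) (\<lambda>x. \<Sum>n. t n x) x = (\<Sum>n. (deriv ^^ k) (t n) x)"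
proof -
  define D where "D k x = (\<Sum>n. (deriv ^^ k) (t n) x)" for k x
  have D: "(D k has_real_derivative D (Suc k) x) (at x)" for k x
    unfolding D_def
  proof (rule has_field_derivative_series'[OF convex_UNIV])
    show "uniformly_convergent_on UNIV (\<lambda>n x. \<Sum>i<n. (deriv ^^ Suc k) (t i) x)"
      using M by (intro Weierstrass_m_test'[where M="M (Suc k)"]) (auto simp del: funpow.simps)
    show "summable (\<lambda>n. (deriv ^^ k) (t n) 0)"
      by (rule summable_comparison_test'[OF M(1)[of k]]) (use M(2) in auto)
  qed (use smooth_has_derivs[OF t] in \<open>auto simp del: funpow.simps\<close>)
  have D0: "(\<lambda>x. \<Sum>n. t n x) = D 0" by (simp add: D_def fun_eq_iff)
  show "(\<lambda>x. \<Sum>n. t n x) \<in> smooth_functions"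
    unfolding D0 by (rule smooth_seqI(1)[of D, OF D])
  show "(deriv ^^ k) (\<lambda>x. \<Sum>n. t n x) x = (\<Sum>n. (deriv ^^ k) (t n) x)"
    unfolding D0 using smooth_seqI(2)[of D, OF D] by (simp add: D_def)
qed

text \<open>\<open>N n\<close> is the largest M \<le> n whose constants of order up to M are at most
  4^n. Any fixed degree becomes admissible at some level, its constants being finite in number, so
  \<open>N n\<close> tends to infinity.\<close>

lemma slowly_growing_degrees:
  fixes B :: "nat \<Rightarrow> nat \<Rightarrow> real"
  shows "\<exists>N. \<forall>q. \<exists>n0. \<forall>n\<ge>n0. q \<le> N n \<and> (\<forall>k\<le>q. B (N n) k \<le> 4 ^ n)"
proof -
  define S where "S n = {M \<in> {..n}. \<forall>k\<le>M. B M k \<le> 4 ^ n}" for n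
  define N where "N n = Max (insert 0 (S n))" for n
  have fin: "finite (insert 0 (S n))" for n by (simp add: S_def)
  have "\<exists>n0. \<forall>n\<ge>n0. q \<le> N n \<and> (\<forall>k\<le>q. B (N n) k \<le> 4 ^ n)" for q
  proof -
    \<comment> \<open>A positive Q rules out the default value 0 of the maximum, so
      \<open>N n\<close> itself is admissible.\<close>
    define Q where "Q = Suc q"
    obtain n1 where n1: "(\<Sum>k\<le>Q. \<bar>B Q k\<bar>) < 4 ^ n1" using real_arch_pow[of 4] by auto
    have "q \<le> N n \<and> (\<forall>k\<le>q. B (N n) k \<le> 4 ^ n)" if n: "n \<ge> max Q n1" for n
    proof -
      have "B Q k \<le> 4 ^ n" if "k \<le> Q" for k
      proof -
        have "\<bar>B Q k\<bar> \<le> (\<Sum>k\<le>Q. \<bar>B Q k\<bar>)" using that by (intro member_le_sum) auto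
        moreover have "(4::real) ^ n1 \<le> 4 ^ n" using n by (intro power_increasing) auto
        ultimately show ?thesis using n1 by linarith
      qed
      then have "Q \<in> S n" using n by (simp add: S_def)
      then have NQ: "Q \<le> N n" unfolding N_def using fin by (intro Max_ge) auto
      have "N n \<in> insert 0 (S n)" unfolding N_def by (rule Max_in) (use fin in auto)
      then have "N n \<in> S n" using NQ by (auto simp: Q_def)
      then show ?thesis using NQ by (simp add: S_def Q_def)
    qed
    then show ?thesis by blast
  qed
  then show ?thesis by blast
qed

section \<open>Lagrange interpolation at the nodes 4^-j\<close>

definition lagrange :: "nat \<Rightarrow> nat \<Rightarrow> real poly" where
  "lagrange N j = (\<Prod>i\<in>{..N} - {j}. smult (1 / (1 / 4 ^ j - 1 / 4 ^ i)) [:- (1 / 4 ^ i), 1:])"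

lemma poly_lagrange_node:
  assumes "i \<le> N" "j \<le> N"
  shows "poly (lagrange N j) (1 / 4 ^ i) = (if i = j then 1 else 0)"
proof (cases "i = j")
  case True
  have "poly (lagrange N j) (1 / 4 ^ j) = 1"
    unfolding lagrange_def poly_prod
  proof (intro prod.neutral ballI)
    fix l assume "l \<in> {..N} - {j}"
    then have "(1::real) / 4 ^ j - 1 / 4 ^ l \<noteq> 0" by (simp add: field_simps)
    moreover have "1 / c * c = 1" if "c \<noteq> 0" for c :: real using that by simp
    ultimately have "1 / (1 / 4 ^ j - 1 / 4 ^ l) * (1 / 4 ^ j - 1 / 4 ^ l :: real) = 1" by blast
    then show "poly (smult (1 / (1 / 4 ^ j - 1 / 4 ^ l)) [:- (1 / 4 ^ l), 1:]) (1 / 4 ^ j) = (1::real)"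
      by (simp only: poly_smult poly_pCons poly_0 mult_zero_right add_0_right mult_1_right
          add.commute[of "- _"] flip: diff_conv_add_uminus)
  qed
  then show ?thesis using True by simp
next
  case False
  then show ?thesis using assms by (auto simp: lagrange_def poly_prod intro!: prod_zero bexI[of _ i])
qed

lemma degree_lagrange: "j \<le> N \<Longrightarrow> degree (lagrange N j) \<le> N"
proof -
  assume j: "j \<le> N"
  have "degree (lagrange N j) \<le> (\<Sum>i\<in>{..N} - {j}. degree (smult (1 / (1 / 4 ^ j - 1 / 4 ^ i)) [:- (1 / 4 ^ i), 1::real:]))"
    unfolding lagrange_def by (rule order_trans[OF degree_prod_sum_le]) auto
  also have "\<dots> \<le> (\<Sum>i\<in>{..N} - {j}. 1)"
    by (intro sum_mono order_trans[OF degree_smult_le]) auto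
  also have "\<dots> = N" using j by simp
  finally show ?thesis .
qed

lemma lagrange_reproduces:
  assumes p: "degree p \<le> N"
  shows "(\<Sum>j\<le>N. poly p (1 / 4 ^ j) * poly (lagrange N j) x) = poly p x"
proof -
  let ?q = "\<Sum>j\<le>N. smult (poly p (1 / 4 ^ j)) (lagrange N j)"
  have "?q = p"
  proof (rule poly_eqI_degree[of "(\<lambda>i. 1 / 4 ^ i) ` {..N}"])
    fix x :: real assume "x \<in> (\<lambda>i. 1 / 4 ^ i) ` {..N}"
    then obtain i where i: "i \<le> N" "x = 1 / 4 ^ i" by auto
    have "poly ?q x = (\<Sum>j\<le>N. poly p (1 / 4 ^ j) * (if i = j then 1 else 0))"
      unfolding poly_sum poly_smult i(2) using i(1) by (intro sum.cong) (auto simp: poly_lagrange_node)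
    then show "poly ?q x = poly p x" using i by (simp add: if_distrib cong: if_cong)
  next
    have "inj (\<lambda>i. 1 / 4 ^ i :: real)" by (auto simp: inj_on_def)
    then have card: "card ((\<lambda>i. 1 / 4 ^ i :: real) ` {..N}) = Suc N"
      by (subst card_image) (auto intro: inj_on_subset)
    show "degree p < card ((\<lambda>i. 1 / 4 ^ i :: real) ` {..N})" using p card by simp
    have "degree ?q \<le> N"
      by (intro degree_sum_le order_trans[OF degree_smult_le] degree_lagrange) auto
    then show "degree ?q < card ((\<lambda>i. 1 / 4 ^ i :: real) ` {..N})" using card by simp
  qed
  then have "poly ?q x = poly p x" by simp
  then show ?thesis by (simp add: poly_sum)
qed

text \<open>The pairs \<open>(u, v)\<close> are the affine maps \<open>y \<mapsto> u + v y\<close> from the unit cell to itself and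
  from each of the two children to their parent.\<close>

definition cells :: "(real \<times> real) set" where
  "cells = {(0, 1), (0, 1 / 4), (3 / 4, 1 / 4)}"

text \<open>The cutoff sees the coordinate y of the cell itself, the polynomial its image under (u,
  v): a parent's basis function can so be read on a child.\<close>

definition bump_lagrange :: "nat \<Rightarrow> nat \<Rightarrow> real \<Rightarrow> real \<Rightarrow> real \<Rightarrow> real" where
  "bump_lagrange N j u v y = cutoff y * poly (lagrange N j) (u + v * y)"

lemma affine_poly_smooth: "(\<lambda>y. poly p (u + v * y)) \<in> smooth_functions"
  by (intro smooth_compose[OF smooth_poly] smooth_add smooth_mult smooth_const smooth_ident)

lemma bump_lagrange_smooth: "bump_lagrange N j u v \<in> smooth_functions"
  unfolding bump_lagrange_def[abs_def] by (intro smooth_mult cutoff_smooth affine_poly_smooth)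

text \<open>After rescaling, every cylinder of every level is one of the three \<open>cells\<close>,
  so one constant per degree and order serves all of them.\<close>

definition basis_bound :: "nat \<Rightarrow> nat \<Rightarrow> real" where
  "basis_bound N k = (SOME B. 0 \<le> B \<and> (\<forall>(u, v)\<in>cells. \<forall>y.
     (\<Sum>j\<le>N. \<bar>(deriv ^^ k) (bump_lagrange N j u v) y\<bar>) \<le> B))"

lemma basis_bound:
  shows "0 \<le> basis_bound N k"
    and "(u, v) \<in> cells \<Longrightarrow> (\<Sum>j\<le>N. \<bar>(deriv ^^ k) (bump_lagrange N j u v) y\<bar>) \<le> basis_bound N k"
proof -
  have "\<exists>B\<ge>0. \<forall>y. \<bar>(deriv ^^ k) (bump_lagrange N j (fst c) (snd c)) y\<bar> \<le> B" for j c
    unfolding bump_lagrange_def[abs_def]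
    by (rule cutoff_mult_bounded[OF affine_poly_smooth, of k "lagrange N j" "fst c" "snd c"]) blast
  then obtain \<beta> where \<beta>: "\<And>j c. \<beta> j c \<ge> 0"
    "\<And>j c y. \<bar>(deriv ^^ k) (bump_lagrange N j (fst c) (snd c)) y\<bar> \<le> \<beta> j c" by metis
  define B where "B = (\<Sum>c\<in>cells. \<Sum>j\<le>N. \<beta> j c)"
  have fin: "finite cells" by (simp add: cells_def)
  have "(\<Sum>j\<le>N. \<bar>(deriv ^^ k) (bump_lagrange N j u v) y\<bar>) \<le> B" if "(u, v) \<in> cells" for u v y
  proof -
    have "(\<Sum>j\<le>N. \<bar>(deriv ^^ k) (bump_lagrange N j u v) y\<bar>) \<le> (\<Sum>j\<le>N. \<beta> j (u, v))"
      using \<beta>(2)[of _ "(u, v)"] by (intro sum_mono) simp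
    also have "\<dots> \<le> B"
      unfolding B_def by (rule member_le_sum[OF that]) (use fin \<beta>(1) in \<open>auto intro: sum_nonneg\<close>)
    finally show ?thesis .
  qed
  moreover have "0 \<le> B" unfolding B_def using \<beta>(1) by (intro sum_nonneg)
  ultimately have "\<exists>B. 0 \<le> B \<and> (\<forall>(u, v)\<in>cells. \<forall>y.
      (\<Sum>j\<le>N. \<bar>(deriv ^^ k) (bump_lagrange N j u v) y\<bar>) \<le> B)" by blast
  from someI_ex[OF this] show "0 \<le> basis_bound N k"
    "(u, v) \<in> cells \<Longrightarrow> (\<Sum>j\<le>N. \<bar>(deriv ^^ k) (bump_lagrange N j u v) y\<bar>) \<le> basis_bound N k"
    unfolding basis_bound_def by auto
qed

definition deg_at :: "nat \<Rightarrow> nat" where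
  "deg_at = (SOME N. \<forall>q. \<exists>n0. \<forall>n\<ge>n0. q \<le> N n \<and> (\<forall>k\<le>q. basis_bound (N n) k \<le> 4 ^ n))"

lemma deg_at:
  obtains n0 where "\<And>n. n \<ge> n0 \<Longrightarrow> q \<le> deg_at n"
    "\<And>n k. n \<ge> n0 \<Longrightarrow> k \<le> q \<Longrightarrow> basis_bound (deg_at n) k \<le> 4 ^ n"
  using someI_ex[OF slowly_growing_degrees[of basis_bound]] unfolding deg_at_def[symmetric]
  by metis

section \<open>The extension operator\<close>

text \<open>The local interpolant of \<open>f\<close> at \<open>cylinder n i\<close>, in the coordinate \<open>y\<close> of a cell
  placed by \<open>(u, v)\<close>, and cut off outside a neighbourhood of that cell.\<close>

definition interpolant :: "(real \<Rightarrow> real) \<Rightarrow> nat \<Rightarrow> nat \<Rightarrow> real \<Rightarrow> real \<Rightarrow> real \<Rightarrow> real" where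
  "interpolant f n i u v y =
     (\<Sum>j\<le>deg_at n. f (cantor_left n i + 1 / 4 ^ j / 4 ^ n) * bump_lagrange (deg_at n) j u v y)"

text \<open>Both interpolants are read in the child's coordinate and carry the child's cutoff, so
  they cancel everywhere when both reproduce the same polynomial.\<close>

definition correction :: "(real \<Rightarrow> real) \<Rightarrow> nat \<Rightarrow> nat \<Rightarrow> real \<Rightarrow> real" where
  "correction f n i x = (let y = 4 ^ Suc n * (x - cantor_left (Suc n) i) in
     interpolant f (Suc n) i 0 1 y - interpolant f n (i div 2) (3 * real (i mod 2) / 4) (1 / 4) y)"

primrec extension_term :: "(real \<Rightarrow> real) \<Rightarrow> nat \<Rightarrow> real \<Rightarrow> real" where
  "extension_term f 0 = interpolant f 0 0 0 1"
| "extension_term f (Suc n) = (\<lambda>x. \<Sum>i<2 ^ Suc n. correction f n i x)"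

definition extension :: "(real \<Rightarrow> real) \<Rightarrow> real \<Rightarrow> real" where
  "extension f x = (\<Sum>n. extension_term f n x)"

lemma child_cell: "(3 * real (i mod 2) / 4, 1 / 4) \<in> cells"
proof -
  have "i mod 2 = 0 \<or> i mod 2 = 1" by auto
  then show ?thesis by (auto simp: cells_def)
qed

lemma interpolant_smooth: "interpolant f n i u v \<in> smooth_functions"
  unfolding interpolant_def[abs_def]
  by (intro smooth_sum smooth_mult smooth_const bump_lagrange_smooth)

lemma interpolant_linear:
  "interpolant (\<lambda>z. a * f z + b * g z) n i u v y = a * interpolant f n i u v y + b * interpolant g n i u v y"
  by (simp add: interpolant_def sum_distrib_left sum.distrib[symmetric] algebra_simps)

lemma interpolant_bound:
  assumes "(u, v) \<in> cells" "\<And>j. \<bar>f (cantor_left n i + 1 / 4 ^ j / 4 ^ n)\<bar> \<le> M"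
  shows "\<bar>(deriv ^^ k) (interpolant f n i u v) y\<bar> \<le> M * basis_bound (deg_at n) k"
proof -
  have M: "0 \<le> M" using assms(2)[of 0] by linarith
  have "\<bar>(deriv ^^ k) (interpolant f n i u v) y\<bar>
      = \<bar>\<Sum>j\<le>deg_at n. f (cantor_left n i + 1 / 4 ^ j / 4 ^ n) * (deriv ^^ k) (bump_lagrange (deg_at n) j u v) y\<bar>"
    unfolding interpolant_def[abs_def]
    by (subst higher_deriv_sum) (auto simp: higher_deriv_cmult[OF bump_lagrange_smooth]
        intro!: smooth_mult bump_lagrange_smooth)
  also have "\<dots> \<le> (\<Sum>j\<le>deg_at n. M * \<bar>(deriv ^^ k) (bump_lagrange (deg_at n) j u v) y\<bar>)"
    using assms(2) by (intro order_trans[OF sum_abs] sum_mono) (auto simp: abs_mult intro: mult_right_mono)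
  also have "\<dots> \<le> M * basis_bound (deg_at n) k"
    unfolding sum_distrib_left[symmetric] by (intro mult_left_mono basis_bound(2) assms M)
  finally show ?thesis .
qed

lemma interpolant_poly:
  assumes "degree p \<le> deg_at n"
  shows "interpolant (poly p) n i u v y = cutoff y * poly p (cantor_left n i + (u + v * y) / 4 ^ n)"
proof -
  \<comment> \<open>This is p in the coordinate of the cylinder, where the nodes become
    4^-j.\<close>
  let ?r = "pcompose p [:cantor_left n i, 1 / 4 ^ n:]"
  have "degree ?r \<le> deg_at n"
    using assms degree_pcompose_le[of p "[:cantor_left n i, 1 / 4 ^ n:]"] by simp
  from lagrange_reproduces[OF this, of "u + v * y"]
  have "(\<Sum>j\<le>deg_at n. poly p (cantor_left n i + 1 / 4 ^ j / 4 ^ n) * poly (lagrange (deg_at n) j) (u + v * y))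
      = poly p (cantor_left n i + (u + v * y) / 4 ^ n)"
    by (simp add: poly_pcompose)
  then show ?thesis
    by (simp add: interpolant_def bump_lagrange_def sum_distrib_left mult_ac flip: sum_distrib_left)
qed

lemma correction_smooth: "correction f n i \<in> smooth_functions"
  unfolding correction_def[abs_def] Let_def
  by (intro smooth_diff smooth_compose[OF interpolant_smooth] smooth_mult smooth_const smooth_ident)

lemma correction_linear:
  "correction (\<lambda>z. a * f z + b * g z) n i x = a * correction f n i x + b * correction g n i x"
  by (simp add: correction_def Let_def interpolant_linear algebra_simps)

lemma correction_poly:
  assumes "degree p \<le> deg_at n" "degree p \<le> deg_at (Suc n)"
  shows "correction (poly p) n i x = 0"
proof -
  let ?y = "4 ^ Suc n * (x - cantor_left (Suc n) i)"
  have "cantor_left (Suc n) i + (0 + 1 * ?y) / 4 ^ Suc n = x" by simp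
  moreover have "cantor_left n (i div 2) + (3 * real (i mod 2) / 4 + 1 / 4 * ?y) / 4 ^ n = x"
    by (simp add: field_simps)
  ultimately show ?thesis
    unfolding correction_def Let_def interpolant_poly[OF assms(1)] interpolant_poly[OF assms(2)]
    by (simp only: diff_self)
qed

lemma correction_bound:
  assumes "\<And>j. \<bar>f (cantor_left (Suc n) i + 1 / 4 ^ j / 4 ^ Suc n)\<bar> \<le> M"
    and "\<And>j. \<bar>f (cantor_left n (i div 2) + 1 / 4 ^ j / 4 ^ n)\<bar> \<le> M"
  shows "\<bar>(deriv ^^ k) (correction f n i) x\<bar>
    \<le> (4 ^ Suc n) ^ k * (M * (basis_bound (deg_at (Suc n)) k + basis_bound (deg_at n) k))"
proof -
  let ?c = "4 ^ Suc n :: real" and ?a = "cantor_left (Suc n) i"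
  let ?F = "interpolant f (Suc n) i 0 1"
    and ?G = "interpolant f n (i div 2) (3 * real (i mod 2) / 4) (1 / 4)"
  have sm: "(\<lambda>x. ?F (?c * (x - ?a))) \<in> smooth_functions" "(\<lambda>x. ?G (?c * (x - ?a))) \<in> smooth_functions"
    by (intro smooth_compose[OF interpolant_smooth] smooth_mult smooth_diff smooth_const smooth_ident)+
  have "(deriv ^^ k) (correction f n i) x
      = ?c ^ k * ((deriv ^^ k) ?F (?c * (x - ?a)) - (deriv ^^ k) ?G (?c * (x - ?a)))"
    unfolding correction_def[abs_def] Let_def higher_deriv_diff[OF sm]
      higher_deriv_affine[OF interpolant_smooth] by (simp add: right_diff_distrib)
  then have "\<bar>(deriv ^^ k) (correction f n i) x\<bar>
      = ?c ^ k * \<bar>(deriv ^^ k) ?F (?c * (x - ?a)) - (deriv ^^ k) ?G (?c * (x - ?a))\<bar>"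
    by (simp add: abs_mult)
  also have "\<dots> \<le> ?c ^ k * (M * basis_bound (deg_at (Suc n)) k + M * basis_bound (deg_at n) k)"
  proof (intro mult_left_mono order_trans[OF abs_triangle_ineq4] add_mono)
    show "\<bar>(deriv ^^ k) ?F (?c * (x - ?a))\<bar> \<le> M * basis_bound (deg_at (Suc n)) k"
      using assms by (intro interpolant_bound) (auto simp: cells_def)
    show "\<bar>(deriv ^^ k) ?G (?c * (x - ?a))\<bar> \<le> M * basis_bound (deg_at n) k"
      using assms by (intro interpolant_bound child_cell) auto
  qed simp
  finally show ?thesis by (simp add: distrib_left)
qed

section \<open>Decay of the corrections\<close>

definition taylor_polynomial :: "(real \<Rightarrow> real) \<Rightarrow> nat \<Rightarrow> real \<Rightarrow> real poly" where
  "taylor_polynomial F q y = (\<Sum>i\<le>q. smult ((deriv ^^ i) F y / fact i) ([:- y, 1:] ^ i))"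

lemma poly_taylor_polynomial: "poly (taylor_polynomial F q y) x = F x - jet_rem F q 0 y x"
  by (simp add: taylor_polynomial_def jet_rem_def poly_sum)

lemma degree_taylor_polynomial: "degree (taylor_polynomial F q y) \<le> q"
  unfolding taylor_polynomial_def
proof (intro degree_sum_le order_trans[OF degree_smult_le])
  fix i assume "i \<in> {..q}"
  moreover have "degree ([:- y, 1:] ^ i) \<le> i"
    using degree_power_le[of "[:- y, 1:]" i] by simp
  ultimately show "degree ([:- y, 1:] ^ i) \<le> q" by simp
qed simp

text \<open>The factors 1 and - 1 match the form of \<open>interpolant_linear\<close> and
  \<open>correction_linear\<close>.\<close>

lemma taylor_approx_on_cantor:
  assumes F: "F \<in> smooth_functions" and xy: "x \<in> cantor" "y \<in> cantor" and d: "\<bar>x - y\<bar> \<le> d"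
  shows "\<bar>1 * trace_on cantor F x + (- 1) * poly (taylor_polynomial F q y) x\<bar>
    \<le> whitney_norm cantor q (trace_on cantor F) * d ^ q"
proof -
  have "\<bar>1 * trace_on cantor F x + (- 1) * poly (taylor_polynomial F q y) x\<bar> = \<bar>jet_rem F q 0 y x\<bar>"
    using xy by (simp add: poly_taylor_polynomial trace_on_def)
  also have "\<dots> \<le> whitney_norm cantor q (trace_on cantor F) * \<bar>x - y\<bar> ^ (q - 0)"
    by (rule cantor.whitney_norm_upper_rem[OF F _ xy]) simp
  also have "\<dots> \<le> whitney_norm cantor q (trace_on cantor F) * d ^ q"
    using d F by (simp add: mult_left_mono power_mono cantor.whitney_norm_nonneg cantor.trace_on_whitney)
  finally show ?thesis .
qed

lemma parent_less: "i < 2 ^ Suc n \<Longrightarrow> i div 2 < (2::nat) ^ n"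
  by auto

lemma node_in_cylinder: "cantor_left n i + 1 / 4 ^ j / 4 ^ n \<in> cylinder n i"
proof -
  have "1 / 4 ^ j \<le> (1::real)" by (simp add: divide_le_eq_1)
  then have "1 / 4 ^ j / 4 ^ n \<le> (1::real) / 4 ^ n" by (rule divide_right_mono) simp
  then show ?thesis by (simp add: cylinder_def)
qed

text \<open>The Taylor polynomial of degree q at the left end of the parent has zero correction.
  What remains at the nodes is a Whitney remainder over distances of at most 4^-n.\<close>

lemma correction_decay:
  assumes F: "F \<in> smooth_functions" and i: "i < 2 ^ Suc n"
    and q: "q \<le> deg_at n" "q \<le> deg_at (Suc n)"
  shows "\<bar>(deriv ^^ k) (correction (trace_on cantor F) n i) x\<bar>
    \<le> (4 ^ Suc n) ^ k * (whitney_norm cantor q (trace_on cantor F) * (1 / 4 ^ n) ^ q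
       * (basis_bound (deg_at (Suc n)) k + basis_bound (deg_at n) k))"
proof -
  let ?y = "cantor_left n (i div 2)"
  define T where "T = taylor_polynomial F q ?y"
  have T: "degree T \<le> deg_at n" "degree T \<le> deg_at (Suc n)"
    using degree_taylor_polynomial[of F q ?y] q by (simp_all add: T_def)
  have y: "?y \<in> cantor" by (rule cylinder_left_in_cantor[OF parent_less[OF i]])
  have close: "\<bar>z - ?y\<bar> \<le> 1 / 4 ^ n" if "z \<in> cylinder n (i div 2)" for z
    using that by (simp add: cylinder_def)
  have eq: "correction (trace_on cantor F) n i = correction (\<lambda>z. 1 * trace_on cantor F z + (- 1) * poly T z) n i"
    unfolding correction_linear correction_poly[OF T] by (simp add: fun_eq_iff correction_linear correction_poly[OF T])
  show ?thesis
    unfolding eq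
  proof (rule correction_bound)
    fix j
    show "\<bar>1 * trace_on cantor F (cantor_left (Suc n) i + 1 / 4 ^ j / 4 ^ Suc n)
        + (- 1) * poly T (cantor_left (Suc n) i + 1 / 4 ^ j / 4 ^ Suc n)\<bar>
      \<le> whitney_norm cantor q (trace_on cantor F) * (1 / 4 ^ n) ^ q"
      unfolding T_def
      by (intro taylor_approx_on_cantor F y close cantor_node i subsetD[OF cylinder_nested] node_in_cylinder)
    show "\<bar>1 * trace_on cantor F (?y + 1 / 4 ^ j / 4 ^ n) + (- 1) * poly T (?y + 1 / 4 ^ j / 4 ^ n)\<bar>
      \<le> whitney_norm cantor q (trace_on cantor F) * (1 / 4 ^ n) ^ q"
      unfolding T_def
      by (intro taylor_approx_on_cantor F y close cantor_node parent_less i node_in_cylinder)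
  qed
qed

lemma extension_term_smooth: "extension_term f n \<in> smooth_functions"
  by (cases n) (auto intro!: interpolant_smooth smooth_sum correction_smooth simp del: power_Suc)

lemma trace_le_norm:
  assumes F: "F \<in> smooth_functions" and x: "x \<in> cantor"
  shows "\<bar>trace_on cantor F x\<bar> \<le> whitney_norm cantor q (trace_on cantor F)"
  using cantor.whitney_norm_upper[OF F _ x, of 0 q] x by (simp add: trace_on_def)

text \<open>For the finitely many levels at which the degrees may still be below q, so that no
  Taylor polynomial of degree q can be removed; a bound without decay suffices there.\<close>

lemma extension_term_crude:
  "\<exists>C\<ge>0. \<forall>F\<in>smooth_functions. \<forall>x.
    \<bar>(deriv ^^ k) (extension_term (trace_on cantor F) n) x\<bar> \<le> C * whitney_norm cantor q (trace_on cantor F)"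
proof (cases n)
  case 0
  have "\<bar>(deriv ^^ k) (extension_term (trace_on cantor F) n) x\<bar>
      \<le> basis_bound (deg_at 0) k * whitney_norm cantor q (trace_on cantor F)"
    if F: "F \<in> smooth_functions" for F x
    unfolding 0 extension_term.simps mult.commute[of "basis_bound _ _"]
    by (rule interpolant_bound) (auto simp: cells_def intro!: trace_le_norm F cantor_node[of 0 0, simplified])
  then show ?thesis using basis_bound(1) by blast
next
  case (Suc m)
  define C where "C = (4 ^ Suc m) ^ k * (basis_bound (deg_at (Suc m)) k + basis_bound (deg_at m) k)"
  have C: "C \<ge> 0" unfolding C_def by (intro mult_nonneg_nonneg add_nonneg_nonneg basis_bound(1)) auto
  have "\<bar>(deriv ^^ k) (extension_term (trace_on cantor F) n) x\<bar>
      \<le> (2 ^ Suc m * C) * whitney_norm cantor q (trace_on cantor F)"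
    if F: "F \<in> smooth_functions" for F x
  proof -
    have "\<bar>(deriv ^^ k) (correction (trace_on cantor F) m i) x\<bar> \<le> C * whitney_norm cantor q (trace_on cantor F)"
      if i: "i < 2 ^ Suc m" for i
      using correction_bound[of "trace_on cantor F" m i, OF trace_le_norm[OF F cantor_node[OF i]]
          trace_le_norm[OF F cantor_node[OF parent_less[OF i]]], of k x q]
      by (simp only: C_def mult_ac)
    then have "\<bar>\<Sum>i<2 ^ Suc m. (deriv ^^ k) (correction (trace_on cantor F) m i) x\<bar>
        \<le> (\<Sum>i<2 ^ Suc m::nat. C * whitney_norm cantor q (trace_on cantor F))"
      by (intro order_trans[OF sum_abs] sum_mono) auto
    then show ?thesis
      unfolding Suc extension_term.simps by (subst higher_deriv_sum) (auto simp: correction_smooth)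
  qed
  then show ?thesis using C by (intro exI[of _ "2 ^ Suc m * C"]) auto
qed

text \<open>Counting powers of 4^m at level m + 1: p from differentiation, one from the constants, -
  q from the remainder. With q = p + 2 this leaves 4^-m, and adding 2^(m+1) corrections still leaves
  2^-m up to a factor.\<close>

lemma extension_term_decay:
  assumes q: "q = p + 2"
  shows "\<exists>C\<ge>0. \<exists>n0. \<forall>n\<ge>n0. \<forall>k\<le>p. \<forall>F\<in>smooth_functions. \<forall>x.
    \<bar>(deriv ^^ k) (extension_term (trace_on cantor F) n) x\<bar> \<le> C * whitney_norm cantor q (trace_on cantor F) * (1/2) ^ n"
proof -
  obtain n0 where n0: "\<And>n. n \<ge> n0 \<Longrightarrow> q \<le> deg_at n"
    "\<And>n k. n \<ge> n0 \<Longrightarrow> k \<le> q \<Longrightarrow> basis_bound (deg_at n) k \<le> 4 ^ n" by (rule deg_at[of q]) blast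
  have "\<bar>(deriv ^^ k) (extension_term (trace_on cantor F) n) x\<bar>
      \<le> (20 * 4 ^ p) * whitney_norm cantor q (trace_on cantor F) * (1/2) ^ n"
    if n: "n \<ge> Suc n0" and k: "k \<le> p" and F: "F \<in> smooth_functions" for n k F x
  proof -
    obtain m where m: "n = Suc m" "m \<ge> n0" using n by (cases n) auto
    define A where "A = whitney_norm cantor q (trace_on cantor F)"
    have A: "A \<ge> 0" unfolding A_def by (intro cantor.whitney_norm_nonneg cantor.trace_on_whitney F)
    have "\<bar>(deriv ^^ k) (correction (trace_on cantor F) m i) x\<bar> \<le> 5 * 4 ^ p * A / 4 ^ m"
      if i: "i < 2 ^ Suc m" for i
    proof -
      have "\<bar>(deriv ^^ k) (correction (trace_on cantor F) m i) x\<bar>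
          \<le> (4 ^ Suc m) ^ k * (A * (1 / 4 ^ m) ^ q * (basis_bound (deg_at (Suc m)) k + basis_bound (deg_at m) k))"
        unfolding A_def using m by (intro correction_decay F i n0) auto
      also have "\<dots> \<le> (4 ^ Suc m) ^ p * (A * (1 / 4 ^ m) ^ q * (4 ^ Suc m + 4 ^ m))"
      proof (rule mult_mono[OF power_increasing mult_left_mono[OF add_mono]])
        show "basis_bound (deg_at (Suc m)) k \<le> 4 ^ Suc m" "basis_bound (deg_at m) k \<le> 4 ^ m"
          using m k q by (intro n0; simp)+
        show "1 \<le> (4::real) ^ Suc m" by (rule one_le_power) simp
      qed (use A k basis_bound(1) in \<open>auto intro: add_nonneg_nonneg mult_nonneg_nonneg\<close>)
      also have "\<dots> = 5 * 4 ^ p * A / 4 ^ m"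
        by (simp add: q power_mult_distrib power_divide field_simps power_add power2_eq_square)
      finally show ?thesis .
    qed
    then have "\<bar>\<Sum>i<2 ^ Suc m. (deriv ^^ k) (correction (trace_on cantor F) m i) x\<bar>
        \<le> (\<Sum>i<2 ^ Suc m::nat. 5 * 4 ^ p * A / 4 ^ m)"
      by (intro order_trans[OF sum_abs] sum_mono) auto
    also have "\<dots> = 20 * 4 ^ p * A * (1/2) ^ n"
    proof -
      have "(4::real) ^ m = 2 ^ m * 2 ^ m" by (simp flip: power_mult_distrib)
      then show ?thesis by (simp add: m power_divide field_simps)
    qed
    finally show ?thesis
      unfolding m(1) extension_term.simps A_def by (subst higher_deriv_sum) (auto simp: correction_smooth)
  qed
  then show ?thesis by (intro exI[of _ "20 * 4 ^ p"] conjI exI[of _ "Suc n0"]) auto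
qed

lemma extension_term_bound:
  assumes q: "q = p + 2"
  obtains C where "C \<ge> 0" "\<And>n k F x. k \<le> p \<Longrightarrow> F \<in> smooth_functions \<Longrightarrow>
    \<bar>(deriv ^^ k) (extension_term (trace_on cantor F) n) x\<bar> \<le> C * whitney_norm cantor q (trace_on cantor F) * (1/2) ^ n"
proof -
  obtain C1 n0 where C1: "C1 \<ge> 0" "\<And>n k F x. n \<ge> n0 \<Longrightarrow> k \<le> p \<Longrightarrow> F \<in> smooth_functions \<Longrightarrow>
    \<bar>(deriv ^^ k) (extension_term (trace_on cantor F) n) x\<bar> \<le> C1 * whitney_norm cantor q (trace_on cantor F) * (1/2) ^ n"
    using extension_term_decay[OF q] by blast
  have "\<forall>n k. \<exists>C\<ge>0. \<forall>F\<in>smooth_functions. \<forall>x.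
    \<bar>(deriv ^^ k) (extension_term (trace_on cantor F) n) x\<bar> \<le> C * whitney_norm cantor q (trace_on cantor F)"
    using extension_term_crude by blast
  then obtain R where R: "\<And>n k. R n k \<ge> 0" "\<And>n k F x. F \<in> smooth_functions \<Longrightarrow>
    \<bar>(deriv ^^ k) (extension_term (trace_on cantor F) n) x\<bar> \<le> R n k * whitney_norm cantor q (trace_on cantor F)"
    by metis
  \<comment> \<open>The factor 2^n compensates (1/2)^n on the finitely many early levels.\<close>
  define C where "C = C1 + (\<Sum>n<n0. \<Sum>k\<le>p. R n k * 2 ^ n)"
  have nn: "0 \<le> (\<Sum>n<n0. \<Sum>k\<le>p. R n k * 2 ^ n)" using R(1) by (intro sum_nonneg) auto
  show ?thesis
  proof (rule that[of C])
    show "C \<ge> 0" using C1(1) nn by (simp add: C_def)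
    fix n k F x assume k: "k \<le> p" and F: "F \<in> smooth_functions"
    define A where "A = whitney_norm cantor q (trace_on cantor F)"
    have A: "A \<ge> 0" unfolding A_def by (intro cantor.whitney_norm_nonneg cantor.trace_on_whitney F)
    show "\<bar>(deriv ^^ k) (extension_term (trace_on cantor F) n) x\<bar> \<le> C * whitney_norm cantor q (trace_on cantor F) * (1/2) ^ n"
    proof (cases "n < n0")
      case True
      have "R n k * 2 ^ n \<le> (\<Sum>k\<le>p. R n k * 2 ^ n)"
        using k R(1) by (intro member_le_sum) auto
      also have "\<dots> \<le> (\<Sum>n<n0. \<Sum>k\<le>p. R n k * 2 ^ n)"
        using True R(1) by (intro member_le_sum[of n]) (auto intro: sum_nonneg)
      finally have "R n k * 2 ^ n \<le> C" using C1(1) by (simp add: C_def)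
      then have "R n k \<le> C * (1/2) ^ n" by (simp add: power_one_over field_simps)
      then have "R n k * A \<le> C * (1/2) ^ n * A" using A by (rule mult_right_mono)
      then show ?thesis using R(2)[OF F, of k n x] by (simp add: A_def mult_ac)
    next
      case False
      have "C1 * A * (1/2) ^ n \<le> C * A * (1/2) ^ n"
        using A nn by (intro mult_right_mono) (auto simp: C_def)
      then show ?thesis using C1(2)[of n k F x] False k F by (simp add: A_def)
    qed
  qed
qed

section \<open>Smoothness, continuity and linearity of the operator\<close>

lemma summable_half: "summable (\<lambda>n. c * (1/2::real) ^ n)"
  by (intro summable_mult summable_geometric) simp

lemma suminf_half: "(\<Sum>n. c * (1/2::real) ^ n) = 2 * c"
  using suminf_mult[OF summable_geometric[of "1/2::real"], of c] suminf_geometric[of "1/2::real"] by simp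

text \<open>Each order k of differentiation has its own geometric majorant, controlled by the
  Whitney norm of order k + 2.\<close>

lemma extension_smooth:
  assumes F: "F \<in> smooth_functions"
  shows "extension (trace_on cantor F) \<in> smooth_functions"
    and "(deriv ^^ k) (extension (trace_on cantor F)) x
      = (\<Sum>n. (deriv ^^ k) (extension_term (trace_on cantor F) n) x)"
proof -
  have "\<exists>C. \<forall>n x. \<bar>(deriv ^^ k) (extension_term (trace_on cantor F) n) x\<bar> \<le> C * (1/2) ^ n" for k
    using extension_term_bound[OF refl, of k] F by (metis le_refl)
  then obtain C where C: "\<And>k n x. \<bar>(deriv ^^ k) (extension_term (trace_on cantor F) n) x\<bar> \<le> C k * (1/2) ^ n"
    by metis
  show "extension (trace_on cantor F) \<in> smooth_functions"
    "(deriv ^^ k) (extension (trace_on cantor F)) x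
      = (\<Sum>n. (deriv ^^ k) (extension_term (trace_on cantor F) n) x)"
    unfolding extension_def[abs_def]
    by (rule smooth_series[where M="\<lambda>k n. C k * (1/2) ^ n", OF extension_term_smooth summable_half C])+
qed

lemma extension_term_summable:
  assumes F: "F \<in> smooth_functions"
  shows "summable (\<lambda>n. (deriv ^^ k) (extension_term (trace_on cantor F) n) x)"
proof -
  obtain C where "\<And>n. \<bar>(deriv ^^ k) (extension_term (trace_on cantor F) n) x\<bar> \<le> C * (1/2) ^ n"
    using extension_term_bound[OF refl, of k] F by (metis le_refl)
  then show ?thesis by (intro summable_comparison_test'[OF summable_half]) auto
qed

lemma extension_bound:
  "\<exists>q C. \<forall>f\<in>whitney_functions cantor. smooth_seminorm p (extension f) \<le> C * whitney_norm cantor q f"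
proof -
  obtain C where C: "C \<ge> 0" "\<And>n k F x. k \<le> p \<Longrightarrow> F \<in> smooth_functions \<Longrightarrow>
    \<bar>(deriv ^^ k) (extension_term (trace_on cantor F) n) x\<bar>
      \<le> C * whitney_norm cantor (p + 2) (trace_on cantor F) * (1/2) ^ n"
    by (rule extension_term_bound[OF refl, of p]) blast
  have "smooth_seminorm p (extension f) \<le> 2 * C * whitney_norm cantor (p + 2) f"
    if f: "f \<in> whitney_functions cantor" for f
  proof -
    obtain F where F: "F \<in> smooth_functions" "f = trace_on cantor F"
      using f by (rule cantor.whitney_functionsE)
    show ?thesis
    proof (rule smooth_seminorm_le)
      fix k x assume k: "k \<le> p"
      let ?t = "\<lambda>n. (deriv ^^ k) (extension_term f n) x"
      have t: "\<bar>?t n\<bar> \<le> C * whitney_norm cantor (p + 2) f * (1/2) ^ n" for n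
        using C(2)[OF k F(1)] F(2) by simp
      have sum: "summable (\<lambda>n. \<bar>?t n\<bar>)"
        using t by (intro summable_comparison_test'[OF summable_half]) auto
      have "\<bar>\<Sum>n. ?t n\<bar> \<le> (\<Sum>n. \<bar>?t n\<bar>)" by (rule summable_rabs[OF sum])
      also have "\<dots> \<le> (\<Sum>n. C * whitney_norm cantor (p + 2) f * (1/2) ^ n)"
        by (intro suminf_le t sum summable_half)
      finally show "\<bar>(deriv ^^ k) (extension f) x\<bar> \<le> 2 * C * whitney_norm cantor (p + 2) f"
        unfolding suminf_half F(2) extension_smooth(2)[OF F(1)] by (simp add: mult.assoc)
    qed
  qed
  then show ?thesis by blast
qed

lemma extension_term_linear:
  "extension_term (\<lambda>z. a * f z + b * g z) n x = a * extension_term f n x + b * extension_term g n x"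
  by (cases n) (simp_all add: interpolant_linear correction_linear sum.distrib sum_distrib_left del: power_Suc)

lemma extension_linear:
  assumes "f \<in> whitney_functions cantor" "g \<in> whitney_functions cantor"
  shows "extension (\<lambda>z. a * f z + b * g z) = (\<lambda>x. a * extension f x + b * extension g x)"
proof
  fix x
  have sum: "summable (\<lambda>n. extension_term f n x)" if f: "f \<in> whitney_functions cantor" for f
    using f extension_term_summable[of _ 0 x] by (elim cantor.whitney_functionsE) auto
  show "extension (\<lambda>z. a * f z + b * g z) x = a * extension f x + b * extension g x"
    unfolding extension_def extension_term_linear
    using sum[OF assms(1)] sum[OF assms(2)]
    by (simp add: suminf_add[symmetric] suminf_mult summable_mult)
qed

section \<open>The operator extends\<close>

text \<open>At a point of the Cantor set the series telescopes, since exactly one cutoff of each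
  level does not vanish there.\<close>

lemma extension_partial_sum:
  assumes x: "x \<in> cylinder n i" "i < 2 ^ n" "x \<in> cantor"
  shows "(\<Sum>m<Suc n. extension_term f m x) = interpolant f n i 0 1 (4 ^ n * (x - cantor_left n i))"
  using x(1,2)
proof (induction n arbitrary: i)
  case 0
  then show ?case by simp
next
  case (Suc n)
  let ?y = "\<lambda>j. 4 ^ Suc n * (x - cantor_left (Suc n) j)"
  have "correction f n j x = 0" if j: "j < 2 ^ Suc n" "j \<noteq> i" for j
  proof -
    have x: "cantor_left (Suc n) i \<le> x" "x \<le> cantor_left (Suc n) i + 1 / 4 ^ Suc n"
      using Suc.prems(1) by (auto simp: cylinder_def)
    have three: "3 / 4 ^ Suc n = 3 * (1 / 4 ^ Suc n :: real)" by simp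
    have "?y j \<le> -1 \<or> ?y j \<ge> 2"
    proof (cases "j < i")
      case True
      then have "cantor_left (Suc n) j + 3 / 4 ^ Suc n \<le> cantor_left (Suc n) i"
        using Suc.prems(2) by (rule cantor_left_separated)
      then have "3 * (1 / 4 ^ Suc n) \<le> x - cantor_left (Suc n) j" using x three by linarith
      then have "?y j \<ge> 4 ^ Suc n * (3 * (1 / 4 ^ Suc n))" by (intro mult_left_mono) auto
      then show ?thesis by simp
    next
      case False
      then have "cantor_left (Suc n) i + 3 / 4 ^ Suc n \<le> cantor_left (Suc n) j"
        using j by (intro cantor_left_separated) auto
      then have "x - cantor_left (Suc n) j \<le> - 2 * (1 / 4 ^ Suc n)" using x three by linarith
      then have "?y j \<le> 4 ^ Suc n * (- 2 * (1 / 4 ^ Suc n))" by (intro mult_left_mono) auto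
      then show ?thesis by simp
    qed
    then have "cutoff (?y j) = 0" by (intro cutoff_eq_0)
    then show ?thesis by (simp add: correction_def Let_def interpolant_def bump_lagrange_def)
  qed
  then have "extension_term f (Suc n) x = (\<Sum>j\<in>{i}. correction f n j x)"
    unfolding extension_term.simps using Suc.prems(2) by (intro sum.mono_neutral_right) auto
  also have "\<dots> = interpolant f (Suc n) i 0 1 (?y i)
      - interpolant f n (i div 2) (3 * real (i mod 2) / 4) (1 / 4) (?y i)"
    by (simp add: correction_def Let_def)
  also have "interpolant f n (i div 2) (3 * real (i mod 2) / 4) (1 / 4) (?y i)
      = interpolant f n (i div 2) 0 1 (4 ^ n * (x - cantor_left n (i div 2)))"
  proof -
    let ?z = "4 ^ n * (x - cantor_left n (i div 2))"
    have z: "3 * real (i mod 2) / 4 + 1 / 4 * ?y i = ?z" by (simp add: field_simps)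
    have unit: "0 \<le> 4 ^ m * (x - cantor_left m j) \<and> 4 ^ m * (x - cantor_left m j) \<le> 1"
      if "x \<in> cylinder m j" for m j
      using that by (auto simp: cylinder_def field_simps)
    \<comment> \<open>x lies in the child and in the parent, where both cutoffs are 1, so the
      child's may be exchanged for the parent's; this makes the sum telescope.\<close>
    have "cutoff (?y i) = 1" using unit[OF Suc.prems(1)] by (intro cutoff_eq_1) auto
    moreover have "cutoff ?z = 1"
      using unit[OF subsetD[OF cylinder_nested Suc.prems(1)]] by (intro cutoff_eq_1) auto
    ultimately show ?thesis unfolding interpolant_def bump_lagrange_def z by simp
  qed
  also have "\<dots> = (\<Sum>m<Suc n. extension_term f m x)"
    by (rule Suc.IH[symmetric]) (use Suc.prems cylinder_nested parent_less in blast)+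
  finally show ?case by simp
qed

text \<open>The partial sum at x is the interpolant of the cylinder containing x, which reproduces
  the Taylor polynomial of degree 2 at x. The remainder 4^-(2n) against constants of size 4^n leaves
  an error of order 4^-n.\<close>

lemma extension_extends:
  assumes F: "F \<in> smooth_functions" and x: "x \<in> cantor"
  shows "extension (trace_on cantor F) x = F x"
proof -
  let ?f = "trace_on cantor F"
  define A where "A = whitney_norm cantor 2 ?f"
  obtain n0 where n0: "\<And>n. n \<ge> n0 \<Longrightarrow> 2 \<le> deg_at n"
    "\<And>n k. n \<ge> n0 \<Longrightarrow> k \<le> 2 \<Longrightarrow> basis_bound (deg_at n) k \<le> 4 ^ n" by (rule deg_at[of 2]) blast
  have "\<bar>(\<Sum>m<Suc n. extension_term ?f m x) - F x\<bar> \<le> A * (1/4) ^ n" if n: "n \<ge> n0" for n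
  proof -
    obtain i where i: "i < 2 ^ n" "x \<in> cylinder n i" by (rule cantor_cylinder[OF x])
    let ?y = "4 ^ n * (x - cantor_left n i)"
    define T where "T = taylor_polynomial F 2 x"
    have "degree T \<le> deg_at n"
      using degree_taylor_polynomial[of F 2 x] n0(1)[OF n] by (simp add: T_def)
    from interpolant_poly[OF this] have "interpolant (poly T) n i 0 1 ?y = cutoff ?y * poly T x"
      by simp
    also have "cutoff ?y = 1"
      using i(2) by (intro cutoff_eq_1) (auto simp: cylinder_def field_simps)
    also have "poly T x = F x"
      unfolding T_def poly_taylor_polynomial by (simp add: jet_rem_def sum.atMost_shift zero_power)
    finally have "(\<Sum>m<Suc n. extension_term ?f m x) - F x
        = (deriv ^^ 0) (interpolant (\<lambda>z. 1 * ?f z + (- 1) * poly T z) n i 0 1) ?y"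
      unfolding extension_partial_sum[OF i(2,1) x] funpow_0 interpolant_linear by simp
    also have "\<bar>\<dots>\<bar> \<le> (A * (1 / 4 ^ n) ^ 2) * basis_bound (deg_at n) 0"
      unfolding A_def T_def
    proof (intro interpolant_bound taylor_approx_on_cantor F x cantor_node i)
      fix j
      show "\<bar>cantor_left n i + 1 / 4 ^ j / 4 ^ n - x\<bar> \<le> 1 / 4 ^ n"
        using node_in_cylinder[of n i j] i(2) unfolding cylinder_def atLeastAtMost_iff by linarith
    qed (simp add: cells_def)
    also have "\<dots> \<le> (A * (1 / 4 ^ n) ^ 2) * 4 ^ n"
      using F by (intro mult_left_mono n0 n) (auto simp: A_def cantor.whitney_norm_nonneg cantor.trace_on_whitney)
    also have "\<dots> = A * (1/4) ^ n" by (simp add: power2_eq_square power_one_over)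
    finally show ?thesis .
  qed
  then have "\<forall>\<^sub>F n in sequentially. norm ((\<Sum>m<Suc n. extension_term ?f m x) - F x) \<le> A * (1/4) ^ n"
    by (auto simp: eventually_sequentially)
  moreover have "(\<lambda>n. A * (1/4) ^ n) \<longlonglongrightarrow> 0"
    by (intro tendsto_mult_right_zero LIMSEQ_power_zero) simp
  ultimately have "(\<lambda>n. (\<Sum>m<Suc n. extension_term ?f m x) - F x) \<longlonglongrightarrow> 0"
    by (rule Lim_null_comparison)
  then have "(\<lambda>n. \<Sum>m<Suc n. extension_term ?f m x) \<longlonglongrightarrow> F x"
    by (simp add: LIM_zero_iff)
  then have "(\<lambda>n. extension_term ?f n x) sums F x"
    unfolding sums_def by (rule LIMSEQ_imp_Suc)
  then show ?thesis unfolding extension_def by (rule sums_unique[symmetric])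
qed

theorem cantor_extension: "extension_property cantor"
  unfolding extension_property_def
proof (intro exI[of _ extension] conjI ballI)
  show ran: "extension \<in> whitney_functions cantor \<rightarrow> smooth_functions"
    by (auto elim!: cantor.whitney_functionsE intro: extension_smooth(1))
  have add: "extension (\<lambda>x. f x + g x) = (\<lambda>x. extension f x + extension g x)"
    and diff: "extension (\<lambda>x. f x - g x) = (\<lambda>x. extension f x - extension g x)"
    and cmult: "extension (\<lambda>x. c * f x) = (\<lambda>x. c * extension f x)"
    if "f \<in> whitney_functions cantor" "g \<in> whitney_functions cantor" for f g c
    using extension_linear[OF that, of 1 1] extension_linear[OF that, of 1 "-1"]
      extension_linear[OF that, of c 0] by simp_all
  show "linear_on_functions (whitney_functions cantor) extension"
    unfolding linear_on_functions_def using add cmult by blast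
  show "continuous_map (whitney_topology cantor) smooth_topology extension"
    unfolding whitney_topology_def smooth_topology_def
    by (rule continuous_map_seminorm_topology)
      (use ran diff extension_bound in \<open>auto intro: cantor.whitney_functions_diff cantor.whitney_norm_0
        cantor.whitney_norm_nonneg smooth_seminorm_0 smooth_seminorm_add\<close>)
  fix f assume "f \<in> whitney_functions cantor"
  then show "trace_on cantor (extension f) = f"
    by (elim cantor.whitney_functionsE) (auto simp: trace_on_def extension_extends[unfolded trace_on_def])
qed

section \<open>The two dimension functions and the conclusion\<close>

lemma sqrt_dimension_function: "dimension_function sqrt"
  unfolding dimension_function_def
proof
  show "\<exists>T>0. continuous_on {0<..<T} sqrt \<and> mono_on {0<..<T} sqrt \<and> (\<forall>t\<in>{0<..<T}. 0 < sqrt t)"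
    by (intro exI[of _ 1]) (auto simp: mono_on_def intro: continuous_intros)
  show "(sqrt \<longlongrightarrow> 0) (at_right 0)"
    using tendsto_real_sqrt[OF tendsto_ident_at[of 0 "{0<..}"]] by simp
qed

lemma ident_dimension_function: "dimension_function (\<lambda>t. t)"
  unfolding dimension_function_def
proof
  show "\<exists>T>0. continuous_on {0<..<T} (\<lambda>t::real. t) \<and> mono_on {0<..<T} (\<lambda>t. t) \<and> (\<forall>t\<in>{0<..<T}. 0 < t)"
    by (intro exI[of _ 1]) (auto simp: mono_on_def)
qed (rule tendsto_ident_at)

lemma ident_prec_sqrt: "(\<lambda>t. t) \<prec>\<^sub>d sqrt"
  unfolding dim_prec_def
proof (rule smalloI_tendsto)
  have "(sqrt \<longlongrightarrow> 0) (at_right 0)"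
    using sqrt_dimension_function by (simp add: dimension_function_def)
  then show "((\<lambda>t. t / sqrt t) \<longlongrightarrow> 0) (at_right 0)"
    by (rule Lim_transform_eventually)
      (auto simp: real_div_sqrt intro!: eventually_mono[OF eventually_at_right_less])
  show "\<forall>\<^sub>F t in at_right 0. sqrt t \<noteq> 0"
    by (rule eventually_mono[OF eventually_at_right_less]) auto
qed

theorem proposition8p3:
  shows "\<exists>(h1 :: real \<Rightarrow> real) (h2 :: real \<Rightarrow> real) (K1 :: real set) (K2 :: real set).
           dimension_function h1 \<and> dimension_function h2 \<and> h2 \<prec>\<^sub>d h1 \<and>
           compact K1 \<and> perfect_set K1 \<and> compact K2 \<and> perfect_set K2 \<and>
           h_set h1 K1 \<and> h_set h2 K2 \<and>
           extension_property K1 \<and> \<not> extension_property K2"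
proof (intro exI conjI)
  show "dimension_function sqrt" "dimension_function (\<lambda>t. t)" "(\<lambda>t. t) \<prec>\<^sub>d sqrt"
    by (rule sqrt_dimension_function ident_dimension_function ident_prec_sqrt)+
qed (rule cantor.comp cantor.perf blocks.comp blocks.perf h_set_cantor h_set_blocks
    cantor_extension blocks_no_extension)+

end
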